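(* Let $f:N\to N$ be an eventually expanding, non-renormalizable piecewise affine map of an interval $N=[a,b]$. Then $f$ has the Markov property.
   Context: Intervals always have positive length. A continuous map $f:N\to N$, $N=[a,b]$, is piecewise affine if there exist points $a=a_0<a_1<\dots<a_d<a_{d+1}=b$ such that each $f|[a_i,a_{i+1}]$ is affine, with slope $Df_i$, and $Df_iDf_{i+1}<0$. The points $a_1,\dots,a_d$ are the critical points; $C_f$ is the set of critical points. $|A|$ denotes Lebesgue measure, $orb(A)=\bigcup_{i\ge 0}f^i(A)$, and $\partial U$ is the boundary of $U$. $f$ is eventually expanding if there is an integer $n\ge 1$ such that $|Df^n|>1$ wherever this derivative is defined. A pair $(I,n)$, with $I\subset N$ an interval and $n\ge 1$, is a renormalization of $f$ if $f^n(I)\subset I$, $\overline{I}\neq N$, and the interiors of $f^i(I)$, $i=0,\dots,n-1$, are pairwise disjoint. $f$ is non-renormalizable if it has no renormalization. A nice neighborhood of $C_f$ is an open set $U\supset C_f$, $U\subset N$, such that $orb(\partial U)\cap U=\emptyset$ and every connected component of $U$ contains exactly one critical point; $U_c$ denotes the component containing $c\in C_f$, so $U=\bigcup_{c\in C_f}U_c$. An interval $T\subset N$ is a good interval of time $n\ge 0$ for $U_c$ if $f^n:T\to U_c$ is monotone and onto; it is a good interval for $U$ if it is a good interval for some $U_c$. The mesh of $U$ is the length of its longest connected component. Nice neighborhoods $U$ used to define Markov maps are taken with mesh small enough that every interval $I\subset N$ contains, for every $c\in C_f$, a good interval for $U_c$ of time at least $1$. For such a $U$, let $D\subset N$ be the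 union of all good intervals for $U$ of time at least $1$; each connected component of $D$ is a good interval of time at least $1$. The Markov map $M:D\to U$ defined by $U$ is $M|T=f^n|T$ on each connected component $T$ of $D$ of time $n$. $f$ has the Markov property if there exists such a nice neighborhood $U$ whose Markov map $M:D\to U$ satisfies $|N\setminus D|=0$. *)

theory Defs
  imports "HOL-Analysis.Analysis"
begin

text \<open>
  The interval \<open>N = [a,b]\<close> is \<^term>\<open>{a..b}\<close>.  Maps \<open>N \<rightarrow> N\<close> are total functions on the reals
  of which only the restriction to \<open>N\<close> is ever used.
\<close>

definition proper_interval :: "real set \<Rightarrow> bool" where
  "proper_interval I \<longleftrightarrow> is_interval I \<and> (\<exists>x\<in>I. \<exists>y\<in>I. x < y)"

definition orb :: "(real \<Rightarrow> real) \<Rightarrow> real set \<Rightarrow> real set" where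
  "orb f A = (\<Union>i. (f ^^ i) ` A)"

text \<open>\<open>s i\<close> is the slope of \<open>f\<close> on \<open>[p i, p (i + 1)]\<close>; values of \<open>p\<close> and \<open>s\<close> at larger indices are
  irrelevant.\<close>

definition affine_partition ::
    "real \<Rightarrow> real \<Rightarrow> (real \<Rightarrow> real) \<Rightarrow> nat \<Rightarrow> (nat \<Rightarrow> real) \<Rightarrow> (nat \<Rightarrow> real) \<Rightarrow> bool" where
  "affine_partition a b f d p s \<longleftrightarrow>
     p 0 = a \<and> p (Suc d) = b \<and> (\<forall>i\<le>d. p i < p (Suc i)) \<and>
     (\<forall>i\<le>d. \<forall>x\<in>{p i..p (Suc i)}. f x = f (p i) + s i * (x - p i)) \<and>
     (\<forall>i<d. s i * s (Suc i) < 0)"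

definition piecewise_affine :: "real \<Rightarrow> real \<Rightarrow> (real \<Rightarrow> real) \<Rightarrow> bool" where
  "piecewise_affine a b f \<longleftrightarrow>
     f ` {a..b} \<subseteq> {a..b} \<and> continuous_on {a..b} f \<and> (\<exists>d p s. affine_partition a b f d p s)"

text \<open>Since consecutive slopes have opposite signs, the points of a partition are determined by \<open>f\<close>,
  so all partitions contribute the same points to the following set.\<close>

definition critical_points :: "real \<Rightarrow> real \<Rightarrow> (real \<Rightarrow> real) \<Rightarrow> real set" where
  "critical_points a b f = {c. \<exists>d p s. affine_partition a b f d p s \<and> (\<exists>i\<in>{1..d}. c = p i)}"

definition eventually_expanding :: "real \<Rightarrow> real \<Rightarrow> (real \<Rightarrow> real) \<Rightarrow> bool" where
  "eventually_expanding a b f \<longleftrightarrow>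
     (\<exists>n\<ge>1. \<forall>x\<in>{a..b}. \<forall>D. ((f ^^ n) has_real_derivative D) (at x within {a..b}) \<longrightarrow> \<bar>D\<bar> > 1)"

definition renormalization ::
    "real \<Rightarrow> real \<Rightarrow> (real \<Rightarrow> real) \<Rightarrow> real set \<Rightarrow> nat \<Rightarrow> bool" where
  "renormalization a b f I n \<longleftrightarrow>
     proper_interval I \<and> I \<subseteq> {a..b} \<and> n \<ge> 1 \<and> (f ^^ n) ` I \<subseteq> I \<and> closure I \<noteq> {a..b} \<and>
     disjoint_family_on (\<lambda>i. interior ((f ^^ i) ` I)) {..<n}"

definition non_renormalizable :: "real \<Rightarrow> real \<Rightarrow> (real \<Rightarrow> real) \<Rightarrow> bool" where
  "non_renormalizable a b f \<longleftrightarrow> \<not> (\<exists>I n. renormalization a b f I n)"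

definition nice_neighborhood :: "real \<Rightarrow> real \<Rightarrow> (real \<Rightarrow> real) \<Rightarrow> real set \<Rightarrow> bool" where
  "nice_neighborhood a b f U \<longleftrightarrow>
     open U \<and> critical_points a b f \<subseteq> U \<and> U \<subseteq> {a..b} \<and>
     orb f (frontier U) \<inter> U = {} \<and>
     (\<forall>V\<in>components U. \<exists>!c. c \<in> critical_points a b f \<and> c \<in> V)"

text \<open>The component \<open>U\<^sub>c\<close> of \<open>U\<close> is \<^term>\<open>connected_component_set U c\<close>.\<close>

definition good_interval_at ::
    "real \<Rightarrow> real \<Rightarrow> (real \<Rightarrow> real) \<Rightarrow> real set \<Rightarrow> real \<Rightarrow> real set \<Rightarrow> nat \<Rightarrow> bool" where
  "good_interval_at a b f U c T n \<longleftrightarrow>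
     proper_interval T \<and> T \<subseteq> {a..b} \<and>
     (mono_on T (f ^^ n) \<or> antimono_on T (f ^^ n)) \<and>
     (f ^^ n) ` T = connected_component_set U c"

definition good_interval ::
    "real \<Rightarrow> real \<Rightarrow> (real \<Rightarrow> real) \<Rightarrow> real set \<Rightarrow> real set \<Rightarrow> nat \<Rightarrow> bool" where
  "good_interval a b f U T n \<longleftrightarrow> (\<exists>c\<in>critical_points a b f. good_interval_at a b f U c T n)"

text \<open>The smallness required of the mesh is exactly the following property; it is inherited by every
  nice neighborhood contained in \<open>U\<close>.\<close>

definition small_mesh :: "real \<Rightarrow> real \<Rightarrow> (real \<Rightarrow> real) \<Rightarrow> real set \<Rightarrow> bool" where
  "small_mesh a b f U \<longleftrightarrow>
     (\<forall>I. proper_interval I \<and> I \<subseteq> {a..b} \<longrightarrow>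
        (\<forall>c\<in>critical_points a b f. \<exists>T n. n \<ge> 1 \<and> T \<subseteq> I \<and> good_interval_at a b f U c T n))"

definition markov_domain :: "real \<Rightarrow> real \<Rightarrow> (real \<Rightarrow> real) \<Rightarrow> real set \<Rightarrow> real set" where
  "markov_domain a b f U = \<Union>{T. \<exists>n\<ge>1. good_interval a b f U T n}"

text \<open>\<open>M\<close> is unconstrained outside the Markov domain.  On a component \<open>T\<close> the time \<open>n\<close> is unique, as an
  iterate \<open>f\<^sup>k\<close> with \<open>k \<ge> 1\<close> is not monotone on any \<open>U\<^sub>c\<close>.\<close>

definition is_markov_map ::
    "real \<Rightarrow> real \<Rightarrow> (real \<Rightarrow> real) \<Rightarrow> real set \<Rightarrow> (real \<Rightarrow> real) \<Rightarrow> bool" where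
  "is_markov_map a b f U M \<longleftrightarrow>
     (\<forall>T\<in>components (markov_domain a b f U).
        \<exists>n\<ge>1. good_interval a b f U T n \<and> (\<forall>x\<in>T. M x = (f ^^ n) x))"

definition markov_property :: "real \<Rightarrow> real \<Rightarrow> (real \<Rightarrow> real) \<Rightarrow> bool" where
  "markov_property a b f \<longleftrightarrow>
     (\<exists>U M. nice_neighborhood a b f U \<and> small_mesh a b f U \<and> is_markov_map a b f U M \<and>
        {a..b} - markov_domain a b f U \<in> null_sets lebesgue)"

end

theory Submission imports Defs begin

text \<open>
  All that follows rests on two consequences of the hypotheses.

  Expansion gives growth. Take an iterate \<open>F\<close> of \<open>f\<close> with slopes of modulus at least 3. A short interval
  breaks into at most two affine pieces under \<open>F\<close>, and the pieces together are at least three times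
  as long as the interval; so the points of an interval whose pieces stay short for \<open>n\<close> steps have measure of order
  \<open>(2/3)\<^sup>n\<close>. Almost every point of any interval therefore lies in a subinterval that an iterate maps affinely
  onto an interval of length at least some fixed \<open>\<delta>\<close> (\<open>growth_scale_exists\<close>). Since every interval of length
  \<open>\<delta>\<close> contains a member of a finite grid, statements about all intervals reduce to the grid
  (\<open>affine_onto_grid\<close>).

  The absence of renormalizations gives density. Let \<open>y\<close> be interior, and consider the points that are
  mapped to \<open>y\<close> by an iterate without meeting a critical point or an end point before. If
  they were not dense, then \<open>f\<close> would send each gap of their closure into the closure of a gap, because \<open>f\<close>
  cannot cross a value without taking it at a noncritical point. Expansion makes the gaps meet critical
  points infinitely often, so one of them returns, and its closure is a renormalization
  (\<open>noncritical_preorbit_dense\<close>).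

  Growth on the grid also produces periodic points outside any given finite set, in particular a
  periodic orbit \<open>Z\<close> that no critical orbit meets. The components around the critical points of the
  complement of \<open>f\<^sup>-\<^sup>n(Z)\<close> form, by density, nice neighborhoods of arbitrarily small mesh for
  large \<open>n\<close> (\<open>small_nice_neighborhood\<close>). Density and the grid show that every interval contains good intervals for all
  critical points once the mesh is small (\<open>small_mesh_if_small\<close>). Good intervals are open, and nested
  or disjoint, so those of minimal time are the components of the Markov domain
  (\<open>markov_domain_component\<close>). Finally the Markov domain fills a fixed proportion of every interval with a
  large affine image; by growth the same holds for all intervals, also in the complement of
  what is already filled, so that the Markov domain has full measure
  (\<open>markov_domain_full_measure\<close>).
\<close>

section \<open>Maps of constant slope on a set\<close>

text \<open>Affinity on \<open>T\<close>, in a form that composes without reference to an intercept.\<close>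

definition has_slope :: "(real \<Rightarrow> real) \<Rightarrow> real \<Rightarrow> real set \<Rightarrow> bool" where
  "has_slope g \<beta> T \<longleftrightarrow> (\<forall>x\<in>T. \<forall>y\<in>T. g y - g x = \<beta> * (y - x))"

lemma has_slopeD: "has_slope g \<beta> T \<Longrightarrow> x \<in> T \<Longrightarrow> y \<in> T \<Longrightarrow> g y = g x + \<beta> * (y - x)"
  unfolding has_slope_def by (smt (verit, best))

lemma has_slope_subset: "has_slope g \<beta> T \<Longrightarrow> S \<subseteq> T \<Longrightarrow> has_slope g \<beta> S"
  unfolding has_slope_def by blast

lemma has_slope_compose:
  assumes "has_slope g \<beta> T" "has_slope h \<gamma> (g ` T)"
  shows "has_slope (h \<circ> g) (\<gamma> * \<beta>) T"
proof -
  have "h (g y) - h (g x) = \<gamma> * \<beta> * (y - x)" if "x \<in> T" "y \<in> T" for x y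
  proof -
    have "h (g y) - h (g x) = \<gamma> * (g y - g x)" "g y - g x = \<beta> * (y - x)"
      using assms that unfolding has_slope_def by blast+
    then show ?thesis by simp
  qed
  then show ?thesis by (simp add: has_slope_def)
qed

lemma has_slope_funpow_0: "has_slope (f ^^ 0) 1 T"
  by (simp add: has_slope_def)

lemma has_slope_funpow_add:
  assumes "has_slope (f ^^ m) \<beta> T" "has_slope (f ^^ n) \<gamma> ((f ^^ m) ` T)"
  shows "has_slope (f ^^ (n + m)) (\<gamma> * \<beta>) T"
  using has_slope_compose[OF assms] by (simp add: funpow_add)

lemma has_slope_unique:
  assumes "has_slope g \<beta> T" "has_slope g \<gamma> T" "x \<in> T" "y \<in> T" "x \<noteq> y"
  shows "\<beta> = \<gamma>"
proof -
  have "\<beta> * (y - x) = g y - g x" "g y - g x = \<gamma> * (y - x)"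
    using assms unfolding has_slope_def by auto
  then show ?thesis using \<open>x \<noteq> y\<close> by simp
qed

lemma has_slope_continuous:
  assumes "has_slope g \<beta> T"
  shows "continuous_on T g"
proof (cases "T = {}")
  case False
  then obtain x0 where x0: "x0 \<in> T" by blast
  have "continuous_on T (\<lambda>x. g x0 + \<beta> * (x - x0))"
    by (intro continuous_intros)
  then show ?thesis
    using has_slopeD[OF assms x0] by (simp cong: continuous_on_cong)
qed simp

lemma has_slope_mono:
  assumes "has_slope g \<beta> T"
  shows "mono_on T g \<or> antimono_on T g"
proof (cases "\<beta> \<ge> 0")
  case True
  have "mono_on T g"
  proof (rule mono_onI)
    fix x y assume "x \<in> T" "y \<in> T" "x \<le> y"
    then have "g y - g x = \<beta> * (y - x)" "\<beta> * (y - x) \<ge> 0"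
      using True assms unfolding has_slope_def by auto
    then show "g x \<le> g y" by simp
  qed
  then show ?thesis ..
next
  case False
  have "antimono_on T g"
  proof (rule monotone_onI)
    fix x y assume "x \<in> T" "y \<in> T" "x \<le> y"
    then have "g y - g x = \<beta> * (y - x)" "\<beta> * (y - x) \<le> 0"
      using False assms unfolding has_slope_def by (auto simp: mult_nonpos_nonneg)
    then show "g x \<ge> g y" by simp
  qed
  then show ?thesis ..
qed

lemma has_slope_inj:
  assumes "has_slope g \<beta> T" "\<beta> \<noteq> 0"
  shows "inj_on g T"
proof (rule inj_onI)
  fix x y assume "x \<in> T" "y \<in> T" "g x = g y"
  then have "0 = \<beta> * (y - x)" using assms(1) unfolding has_slope_def by force
  then show "x = y" using assms(2) by simp
qed

lemma has_slope_image_Icc: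
  assumes "has_slope g \<beta> {u..v}" "u \<le> v"
  obtains p q where "g ` {u..v} = {p..q}" "q - p = \<bar>\<beta>\<bar> * (v - u)"
proof -
  have "g ` {u..v} = (\<lambda>x. \<beta> * x + (g u - \<beta> * u)) ` {u..v}"
    using assms has_slopeD[OF assms(1), of u] by (intro image_cong) (auto simp: algebra_simps)
  also have "\<dots> = (if 0 \<le> \<beta> then {g u..g u + \<beta> * (v - u)} else {g u + \<beta> * (v - u)..g u})"
    using assms(2) by (subst image_affinity_atLeastAtMost) (auto simp: right_diff_distrib)
  finally have eq: "g ` {u..v} = \<dots>" .
  show thesis
  proof (cases "0 \<le> \<beta>")
    case True
    then show thesis using eq by (intro that[of "g u" "g u + \<beta> * (v - u)"]) simp_all
  next
    case False
    then show thesis using eq by (intro that[of "g u + \<beta> * (v - u)" "g u"]) simp_all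
  qed
qed

text \<open>Affine branches are inverted by pulling back intervals; the open version of the branch serves for good
  intervals, the closed one for further compositions.\<close>

lemma has_slope_preimage_Icc:
  assumes sl: "has_slope g \<beta> {u..v}" and "\<beta> \<noteq> 0" "p < q" and sub: "{p..q} \<subseteq> g ` {u..v}"
  obtains u' v' where "{u'..v'} \<subseteq> {u..v}" "u' < v'" "g ` {u'..v'} = {p..q}"
    "g ` {u'<..<v'} = {p<..<q}" "q - p = \<bar>\<beta>\<bar> * (v' - u')"
proof -
  define h where "h w = u + (w - g u) / \<beta>" for w
  have "u \<in> {u..v}" using sub \<open>p < q\<close> by force
  then have gx: "g x = g u + \<beta> * (x - u)" if "x \<in> {u..v}" for x
    using has_slopeD[OF sl] that by blast
  have h: "h w \<in> {u..v} \<and> g (h w) = w" if "w \<in> {p..q}" for w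
  proof -
    from that sub obtain x where x: "x \<in> {u..v}" "g x = w" by blast
    then have "w - g u = \<beta> * (x - u)" using gx[OF x(1)] by simp
    then have "h w = x" using \<open>\<beta> \<noteq> 0\<close> by (simp add: h_def)
    then show ?thesis using x by simp
  qed
  have "h ` {p..q} = (\<lambda>w. (1 / \<beta>) * w + (u - g u / \<beta>)) ` {p..q}"
    by (intro image_cong) (auto simp: h_def diff_divide_distrib)
  also have "\<dots> = (if 0 \<le> \<beta> then {h p..h q} else {h q..h p})"
    by (subst image_affinity_atLeastAtMost) (use \<open>p < q\<close> in \<open>auto simp: h_def diff_divide_distrib\<close>)
  finally have img: "h ` {p..q} = (if 0 \<le> \<beta> then {h p..h q} else {h q..h p})" .
  define u' v' where "u' = min (h p) (h q)" and "v' = max (h p) (h q)"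
  have diff: "h q - h p = (q - p) / \<beta>" by (simp add: h_def diff_divide_distrib)
  have len: "q - p = \<bar>\<beta>\<bar> * \<bar>h q - h p\<bar>"
    unfolding diff using \<open>p < q\<close> \<open>\<beta> \<noteq> 0\<close> by (simp add: abs_divide)
  moreover have "v' - u' = \<bar>h q - h p\<bar>" by (auto simp: u'_def v'_def)
  ultimately have len': "q - p = \<bar>\<beta>\<bar> * (v' - u')" by simp
  have im: "h ` {p..q} = {u'..v'}"
  proof (cases "0 \<le> \<beta>")
    case True
    then have "0 \<le> (q - p) / \<beta>" using \<open>p < q\<close> by simp
    then have "h p \<le> h q" using diff by simp
    then show ?thesis using img True by (simp add: u'_def v'_def)
  next
    case False
    then have "(q - p) / \<beta> \<le> 0" using \<open>p < q\<close> by (simp add: divide_nonneg_neg)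
    then have "h q \<le> h p" using diff by simp
    then show ?thesis using img False by (simp add: u'_def v'_def)
  qed
  have "0 < \<bar>\<beta>\<bar> * (v' - u')" using len' \<open>p < q\<close> by simp
  then have lt: "u' < v'" by (simp add: zero_less_mult_iff)
  have sub': "{u'..v'} \<subseteq> {u..v}"
    unfolding im[symmetric] image_subset_iff using h by blast
  have gim: "g ` {u'..v'} = {p..q}"
    unfolding im[symmetric] image_image using h by simp
  have "{g u', g v'} = {p, q}"
    using h[of p] h[of q] \<open>p < q\<close> by (auto simp: u'_def v'_def min_def max_def)
  moreover have "g ` ({u'..v'} - {u', v'}) = g ` {u'..v'} - g ` {u', v'}"
    using lt by (intro inj_on_image_set_diff[OF has_slope_inj[OF has_slope_subset[OF sl sub'] \<open>\<beta> \<noteq> 0\<close>]]) auto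
  moreover have "{u'..v'} - {u', v'} = {u'<..<v'}" "{p..q} - {p, q} = {p<..<q}" by auto
  ultimately have "g ` {u'<..<v'} = {p<..<q}" using gim by simp
  then show thesis using that sub' lt gim len' by blast
qed

section \<open>Iterates are piecewise affine\<close>

text \<open>\<open>S\<close> is a set of break points and \<open>B\<close> a set that contains all slopes. The slopes are kept track of
  since both finiteness and a lower bound on their modulus matter.\<close>

definition piecewise_slopes :: "real \<Rightarrow> real \<Rightarrow> (real \<Rightarrow> real) \<Rightarrow> real set \<Rightarrow> bool" where
  "piecewise_slopes a b g B \<longleftrightarrow> (\<exists>S. finite S \<and>
     (\<forall>u v. a \<le> u \<and> u < v \<and> v \<le> b \<and> {u<..<v} \<inter> S = {} \<longrightarrow> (\<exists>\<beta>\<in>B. has_slope g \<beta> {u..v})))"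

lemma piecewise_slopes_mono: "piecewise_slopes a b g B \<Longrightarrow> B \<subseteq> B' \<Longrightarrow> piecewise_slopes a b g B'"
  unfolding piecewise_slopes_def by (meson subsetD)

lemma piecewise_slopes_id: "piecewise_slopes a b (f ^^ 0) {1}"
  unfolding piecewise_slopes_def using has_slope_funpow_0 by blast

lemma subinterval_avoiding_finite:
  fixes u v :: real
  assumes "finite X" "u < v"
  obtains u' v' where "u < u'" "u' < v'" "v' < v" "{u'..v'} \<inter> X = {}"
proof -
  have "\<exists>u' v'. u < u' \<and> u' < v' \<and> v' < v \<and> {u'..v'} \<inter> X = {}"
    using assms(1)
  proof induction
    case empty
    show ?case using assms(2) 
      by - (rule exI[of _ "(2 * u + v) / 3"], rule exI[of _ "(u + 2 * v) / 3"], auto)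
  next
    case (insert s X)
    then obtain u' v' where uv: "u < u'" "u' < v'" "v' < v" "{u'..v'} \<inter> X = {}" by blast
    define m where "m = (u' + v') / 2"
    have m: "u' < m" "m < v'" using uv by (auto simp: m_def)
    show ?case
    proof (cases "s \<le> m")
      case True
      have "{(m + v') / 2..v'} \<subseteq> {u'..v'}" using m by auto
      moreover have "s \<notin> {(m + v') / 2..v'}" using True m by auto
      ultimately have "{(m + v') / 2..v'} \<inter> insert s X = {}" using uv(4) by blast
      then show ?thesis using uv m
        by - (rule exI[of _ "(m + v') / 2"], rule exI[of _ v'], auto)
    next
      case False
      then show ?thesis using uv m by - (rule exI[of _ u'], rule exI[of _ m], fastforce)
    qed
  qed
  then show thesis using that by blast
qed

text \<open>Two points of a fibre are separated by a break point, since \<open>g\<close> is injective in between.\<close>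

lemma finite_fibre:
  fixes S :: "real set" and y :: real
  assumes S: "finite S"
    and inj: "\<And>u v. a \<le> u \<Longrightarrow> u < v \<Longrightarrow> v \<le> b \<Longrightarrow> {u<..<v} \<inter> S = {} \<Longrightarrow> g u \<noteq> g v"
  shows "finite {x \<in> {a..b}. g x = y}" (is "finite ?A")
proof -
  let ?n = "\<lambda>x. card (S \<inter> {..x::real})"
  have less: "?n x < ?n z" if "x \<in> ?A" "z \<in> ?A" "x < z" for x z
  proof -
    have "{x<..<z} \<inter> S \<noteq> {}" using inj[of x z] that by auto
    then obtain s where s: "s \<in> {x<..<z} \<inter> S" by blast
    have "S \<inter> {..x} \<subseteq> S \<inter> {..z}" "s \<in> S \<inter> {..z} - S \<inter> {..x}" using s by auto
    then have "S \<inter> {..x} \<subset> S \<inter> {..z}" by blast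
    then show ?thesis using S by (intro psubset_card_mono) auto
  qed
  have "inj_on ?n ?A"
  proof (rule inj_onI)
    fix x z assume xz: "x \<in> ?A" "z \<in> ?A" "?n x = ?n z"
    show "x = z"
    proof (rule ccontr)
      assume "x \<noteq> z"
      then consider "x < z" | "z < x" by linarith
      then show False using less[OF xz(1,2)] less[OF xz(2,1)] xz(3) by cases simp_all
    qed
  qed
  moreover have "?n ` ?A \<subseteq> {..card S}" using S by (force intro!: card_mono)
  ultimately show ?thesis by (meson finite_atMost finite_subset inj_on_finite)
qed

text \<open>The composition breaks at the break points of \<open>g\<close> and where \<open>g\<close> hits a break point of \<open>h\<close>; the latter
  points are finite in number by the previous lemma.\<close>

lemma piecewise_slopes_compose:
  assumes maps: "g ` {a..b} \<subseteq> {a..b}"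
    and g: "piecewise_slopes a b g B" and "0 \<notin> B" and h: "piecewise_slopes a b h B'"
  shows "piecewise_slopes a b (h \<circ> g) {y * x | x y. x \<in> B \<and> y \<in> B'}"
proof -
  obtain S where S: "finite S"
    and Sg: "\<And>u v. a \<le> u \<Longrightarrow> u < v \<Longrightarrow> v \<le> b \<Longrightarrow> {u<..<v} \<inter> S = {} \<Longrightarrow> \<exists>\<beta>\<in>B. has_slope g \<beta> {u..v}"
    using g unfolding piecewise_slopes_def by blast
  obtain S' where S': "finite S'"
    and Sh: "\<And>u v. a \<le> u \<Longrightarrow> u < v \<Longrightarrow> v \<le> b \<Longrightarrow> {u<..<v} \<inter> S' = {} \<Longrightarrow> \<exists>\<beta>\<in>B'. has_slope h \<beta> {u..v}"
    using h unfolding piecewise_slopes_def by blast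
  let ?S = "S \<union> (\<Union>y\<in>S'. {x \<in> {a..b}. g x = y})"
  have "finite {x \<in> {a..b}. g x = y}" for y
  proof (rule finite_fibre[OF S])
    fix u v assume "a \<le> u" "u < v" "v \<le> b" "{u<..<v} \<inter> S = {}"
    then obtain \<beta> where \<beta>: "\<beta> \<in> B" "has_slope g \<beta> {u..v}" using Sg by blast
    then have "inj_on g {u..v}" using \<open>0 \<notin> B\<close> by (metis has_slope_inj)
    then show "g u \<noteq> g v" using \<open>u < v\<close> by (auto dest: inj_onD)
  qed
  then have fin: "finite ?S" using S S' by blast
  have "\<exists>\<gamma>\<in>{y * x | x y. x \<in> B \<and> y \<in> B'}. has_slope (h \<circ> g) \<gamma> {u..v}"
    if uv: "a \<le> u" "u < v" "v \<le> b" "{u<..<v} \<inter> ?S = {}" for u v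
  proof -
    obtain \<beta> where \<beta>: "\<beta> \<in> B" "has_slope g \<beta> {u..v}" using Sg uv by blast
    then have nz: "\<beta> \<noteq> 0" using \<open>0 \<notin> B\<close> by blast
    obtain p q where pq: "g ` {u..v} = {p..q}" "q - p = \<bar>\<beta>\<bar> * (v - u)"
      using has_slope_image_Icc[OF \<beta>(2)] uv(2) by (metis less_imp_le)
    have "p < q" using pq(2) uv(2) nz by (metis diff_gt_0_iff_gt zero_less_abs_iff zero_less_mult_iff)
    obtain u' v' where uv': "{u'..v'} \<subseteq> {u..v}" "u' < v'" "g ` {u'<..<v'} = {p<..<q}"
      using has_slope_preimage_Icc[OF \<beta>(2) nz \<open>p < q\<close>] pq(1) by (metis order_refl)
    have "{p..q} \<subseteq> {a..b}" using pq(1) maps uv by (metis atLeastatMost_subset_iff image_mono order_trans)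
    moreover have "w \<notin> S'" if "w \<in> {p<..<q}" for w
    proof
      assume "w \<in> S'"
      have "w \<in> g ` {u'<..<v'}" using that uv'(3) by simp
      then obtain x where x: "x \<in> {u'<..<v'}" "w = g x" by blast
      moreover have "x \<in> {u<..<v}" using x(1) uv' by auto
      ultimately show False using uv \<open>w \<in> S'\<close> by auto
    qed
    ultimately obtain \<gamma> where \<gamma>: "\<gamma> \<in> B'" "has_slope h \<gamma> {p..q}"
      using Sh[of p q] \<open>p < q\<close> by (auto simp: disjoint_iff)
    then have "has_slope (h \<circ> g) (\<gamma> * \<beta>) {u..v}" using has_slope_compose[OF \<beta>(2)] pq(1) by simp
    then show ?thesis using \<beta>(1) \<gamma>(1) by blast
  qed
  then show ?thesis unfolding piecewise_slopes_def using fin by (intro exI[of _ ?S]) blast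
qed

definition strict_local_extremum :: "(real \<Rightarrow> real) \<Rightarrow> real \<Rightarrow> bool" where
  "strict_local_extremum g c \<longleftrightarrow> (\<exists>e>0. (\<forall>x. 0 < \<bar>x - c\<bar> \<and> \<bar>x - c\<bar> < e \<longrightarrow> g x < g c) \<or>
     (\<forall>x. 0 < \<bar>x - c\<bar> \<and> \<bar>x - c\<bar> < e \<longrightarrow> g x > g c))"

lemma strict_local_extremum_uminus: "strict_local_extremum (\<lambda>x. - g x) c \<longleftrightarrow> strict_local_extremum g c"
  unfolding strict_local_extremum_def by auto

text \<open>At the supremum \<open>z\<close> of the points up to which \<open>g \<le> y\<close>, the function is at most \<open>y\<close> on the left and takes
  values above \<open>y\<close> arbitrarily close on the right.\<close>

lemma upward_crossing:
  assumes cont: "continuous_on {u..v} g" and "u < v" "g u < y" "y < g v"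
  shows "\<exists>z\<in>{u<..<v}. g z = y \<and> \<not> strict_local_extremum g z"
proof -
  define A where "A = {t \<in> {u..v}. \<forall>s\<in>{u..t}. g s \<le> y}"
  have uA: "u \<in> A" using assms by (auto simp: A_def)
  have bdd: "bdd_above A" by (rule bdd_aboveI[of _ v]) (auto simp: A_def)
  define z where "z = Sup A"
  have uz: "u \<le> z" using uA bdd by (simp add: z_def cSup_upper)
  have zv: "z \<le> v" unfolding z_def by (rule cSup_least) (use uA in \<open>auto simp: A_def\<close>)
  have below: "g s \<le> y" if "u \<le> s" "s < z" for s
  proof -
    obtain t where "t \<in> A" "s < t" using \<open>s < z\<close> uA bdd unfolding z_def by (metis empty_iff less_cSup_iff)
    then show ?thesis using that by (auto simp: A_def)
  qed
  have above: "\<exists>t\<in>{z<..<w}. g t > y" if zw: "z < w" "w \<le> v" for w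
  proof (rule ccontr)
    assume neg: "\<not> ?thesis"
    have "g s \<le> y" if s: "s \<in> {u..(z+w)/2}" for s
    proof -
      consider "s < z" | "s = z" | "s > z" by linarith
      then show ?thesis
      proof cases
        case 2
        have "g z \<le> y"
        proof (rule ccontr)
          assume "\<not> g z \<le> y"
          then have "\<forall>\<^sub>F t in at z within {u..v}. g t > y"
            using cont uz zv by (intro order_tendstoD(1)[of g "g z"]) (auto simp: continuous_on_def)
          then obtain d where d: "d > 0" "\<forall>t\<in>{u..v}. t \<noteq> z \<and> dist t z < d \<longrightarrow> g t > y"
            unfolding eventually_at by auto
          obtain t where t: "z < t" "t < min w (z + d)" using dense[of z "min w (z + d)"] \<open>d > 0\<close> zw by auto
          then have "g t > y" using d(2) uz \<open>w \<le> v\<close> by (auto simp: dist_real_def)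
          then show False using t neg by auto
        qed
        then show ?thesis using 2 by simp
      next
        case 3
        then have "s \<in> {z<..<w}" using s \<open>z < w\<close> by (auto simp: field_simps)
        then show ?thesis using neg by force
      qed (use below s in auto)
    qed
    then have "(z+w)/2 \<in> A" using uz that by (auto simp: A_def field_simps)
    then have "(z+w)/2 \<le> z" unfolding z_def using bdd by (rule cSup_upper)
    then show False using \<open>z < w\<close> by simp
  qed
  have gz: "g z = y"
  proof (rule ccontr)
    assume "g z \<noteq> y"
    then consider "g z < y" | "g z > y" by linarith
    then show False
    proof cases
      case 1
      then have "z < v" using zv assms by (metis less_asym order_le_less)
      have "\<forall>\<^sub>F t in at z within {u..v}. g t < y"
        using cont uz zv 1 by (intro order_tendstoD(2)[of g "g z"]) (auto simp: continuous_on_def)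
      then obtain d where d: "d > 0" "\<forall>t\<in>{u..v}. t \<noteq> z \<and> dist t z < d \<longrightarrow> g t < y"
        unfolding eventually_at by auto
      obtain t where "t \<in> {z<..<min v (z + d)}" "g t > y"
        using above[of "min v (z + d)"] \<open>z < v\<close> \<open>d > 0\<close> by auto
      then show False using d(2)[rule_format, of t] uz by (auto simp: dist_real_def)
    next
      case 2
      then have "u < z" using uz assms by (metis less_asym order_le_less)
      have "\<forall>\<^sub>F t in at z within {u..v}. g t > y"
        using cont uz zv 2 by (intro order_tendstoD(1)[of g "g z"]) (auto simp: continuous_on_def)
      then obtain d where d: "d > 0" "\<forall>t\<in>{u..v}. t \<noteq> z \<and> dist t z < d \<longrightarrow> g t > y"
        unfolding eventually_at by auto
      let ?t = "max u (z - d/2)"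
      have "?t < z" "u \<le> ?t" "dist ?t z < d" using \<open>u < z\<close> \<open>d > 0\<close> by (auto simp: dist_real_def)
      then show False using below[of ?t] d(2)[rule_format, of ?t] zv 2 by (smt (verit) atLeastAtMost_iff)
    qed
  qed
  have uz': "u < z" using uz gz assms by (metis less_irrefl order_le_less)
  have zv': "z < v" using zv gz assms by (metis less_irrefl order_le_less)
  have "\<not> strict_local_extremum g z"
  proof
    assume "strict_local_extremum g z"
    then obtain e where e: "e > 0" and alt: "(\<forall>x. 0 < \<bar>x - z\<bar> \<and> \<bar>x - z\<bar> < e \<longrightarrow> g x < g z) \<or>
      (\<forall>x. 0 < \<bar>x - z\<bar> \<and> \<bar>x - z\<bar> < e \<longrightarrow> g x > g z)" unfolding strict_local_extremum_def by blast
    let ?t = "max u (z - e/2)"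
    have t: "g ?t \<le> g z" "0 < \<bar>?t - z\<bar>" "\<bar>?t - z\<bar> < e" using below[of ?t] uz' e gz by auto
    obtain s where s: "s \<in> {z<..<min v (z + e)}" "g s > g z"
      using above[of "min v (z + e)"] zv' e gz by auto
    then have "0 < \<bar>s - z\<bar>" "\<bar>s - z\<bar> < e" by auto
    then show False using alt t s by (metis less_asym not_less)
  qed
  then show ?thesis using gz uz' zv' by auto
qed

lemma transversal_crossing:
  assumes cont: "continuous_on {u..v} g" and "u < v"
    and "g u < y \<and> y < g v \<or> g v < y \<and> y < g u"
  shows "\<exists>z\<in>{u<..<v}. g z = y \<and> \<not> strict_local_extremum g z"
  using assms(3)
proof
  assume "g v < y \<and> y < g u"
  then have "\<exists>z\<in>{u<..<v}. - g z = - y \<and> \<not> strict_local_extremum (\<lambda>x. - g x) z"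
    using assms(2) by (intro upward_crossing continuous_intros cont) auto
  then show ?thesis by (simp add: strict_local_extremum_uminus)
qed (use upward_crossing[OF cont \<open>u < v\<close>] in blast)

lemma has_slope_not_extremum:
  assumes sl: "has_slope g \<beta> {u..v}" and "u < c" "c < v"
  shows "\<not> strict_local_extremum g c"
proof
  assume "strict_local_extremum g c"
  then obtain e where e: "e > 0" and alt: "(\<forall>x. 0 < \<bar>x - c\<bar> \<and> \<bar>x - c\<bar> < e \<longrightarrow> g x < g c) \<or>
      (\<forall>x. 0 < \<bar>x - c\<bar> \<and> \<bar>x - c\<bar> < e \<longrightarrow> g x > g c)" unfolding strict_local_extremum_def by blast
  obtain t where t: "0 < t" "t < min e (min (c - u) (v - c))"
    using dense[of 0 "min e (min (c - u) (v - c))"] e assms by auto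
  have "g (c + t) - g c = \<beta> * t" "g c - g (c - t) = \<beta> * t"
    using sl t assms unfolding has_slope_def by force+
  moreover have "g (c + t) < g c \<and> g (c - t) < g c \<or> g (c + t) > g c \<and> g (c - t) > g c"
    using alt t by (elim disjE) auto
  ultimately show False by linarith
qed

lemma has_slope_derivative:
  assumes sl: "has_slope g \<beta> {u..v}" and "u < x" "x < v"
  shows "(g has_real_derivative \<beta>) (at x within N)"
proof -
  have "((\<lambda>y. g x + \<beta> * (y - x)) has_real_derivative \<beta>) (at x)"
    by (auto intro!: derivative_eq_intros)
  moreover have "g x + \<beta> * (y - x) = g y" if "y \<in> {u<..<v}" for y
    using has_slopeD[OF sl, of x y] that assms by auto
  ultimately have "(g has_real_derivative \<beta>) (at x)"
    using has_field_derivative_transform_within_open[of _ \<beta> x "{u<..<v}" g] assms by auto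
  then show ?thesis by (rule has_field_derivative_at_within)
qed

section \<open>The partition of a piecewise affine map\<close>

context
  fixes a b :: real and f :: "real \<Rightarrow> real" and d :: nat and p s :: "nat \<Rightarrow> real"
  assumes part: "affine_partition a b f d p s"
begin

lemma partition_ends: "p 0 = a" "p (Suc d) = b"
  using part unfolding affine_partition_def by blast+

lemma partition_slope_signs: "i < d \<Longrightarrow> s i * s (Suc i) < 0"
  using part unfolding affine_partition_def by blast

lemma partition_less: "i < j \<Longrightarrow> j \<le> Suc d \<Longrightarrow> p i < p j"
proof (induction j)
  case (Suc j)
  have "p j < p (Suc j)" using part Suc.prems unfolding affine_partition_def by force
  then show ?case using Suc by (cases "i = j") auto
qed simp

lemma partition_slope: "i \<le> d \<Longrightarrow> has_slope f (s i) {p i..p (Suc i)}"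
proof -
  assume "i \<le> d"
  then have "f x = f (p i) + s i * (x - p i)" if "x \<in> {p i..p (Suc i)}" for x
    using part that unfolding affine_partition_def by blast
  then have "f y - f x = s i * (y - x)" if "x \<in> {p i..p (Suc i)}" "y \<in> {p i..p (Suc i)}" for x y
    by (simp only: that right_diff_distrib)
  then show ?thesis unfolding has_slope_def by blast
qed

lemma partition_locate:
  assumes "a \<le> u" "u < b"
  obtains i where "i \<le> d" "p i \<le> u" "u < p (Suc i)"
proof -
  let ?I = "{i. i \<le> d \<and> p i \<le> u}"
  have "0 \<in> ?I" using partition_ends assms by simp
  then have M: "Max ?I \<in> ?I" by (intro Max_in) auto
  have "u < p (Suc (Max ?I))"
  proof (rule ccontr)
    assume neg: "\<not> ?thesis"
    show False
    proof (cases "Max ?I = d")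
      case True
      then show False using neg partition_ends assms by simp
    next
      case False
      then have "Suc (Max ?I) \<in> ?I" using M neg by simp
      then have "Suc (Max ?I) \<le> Max ?I" by (intro Max_ge) auto
      then show False by simp
    qed
  qed
  then show thesis using that M by blast
qed

lemma partition_piece:
  assumes "a \<le> u" "u < v" "v \<le> b" "{u<..<v} \<inter> p ` {1..d} = {}"
  obtains i where "i \<le> d" "{u..v} \<subseteq> {p i..p (Suc i)}"
proof -
  obtain i where i: "i \<le> d" "p i \<le> u" "u < p (Suc i)"
    using partition_locate[of u] assms by auto
  have "v \<le> p (Suc i)"
  proof (cases "i = d")
    case True
    then show ?thesis using partition_ends assms by simp
  next
    case False
    then have "p (Suc i) \<in> p ` {1..d}" using i by (intro imageI) auto
    then show ?thesis using assms i by force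
  qed
  then show thesis using that i by auto
qed

lemma partition_extremum:
  assumes "i \<in> {1..d}"
  shows "strict_local_extremum f (p i)"
proof -
  obtain j where j: "i = Suc j" "j < d" using assms by (cases i) auto
  define e where "e = min (p i - p j) (p (Suc i) - p i)"
  have e: "e > 0" using partition_less[of j i] partition_less[of i "Suc i"] j by (simp add: e_def)
  have left: "f x = f (p i) + s j * (x - p i)" if "x \<in> {p i - e..p i}" for x
    using has_slopeD[OF partition_slope[of j], of "p i" x] j that by (auto simp: e_def)
  have right: "f x = f (p i) + s i * (x - p i)" if "x \<in> {p i..p i + e}" for x
    using has_slopeD[OF partition_slope[of i], of "p i" x] j that by (auto simp: e_def)
  have "s j * s i < 0" using partition_slope_signs j by simp
  then consider "s j > 0" "s i < 0" | "s j < 0" "s i > 0" by (auto simp: mult_less_0_iff)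
  then show ?thesis
  proof cases
    case 1
    have "f x < f (p i)" if "0 < \<bar>x - p i\<bar>" "\<bar>x - p i\<bar> < e" for x
    proof (cases "x < p i")
      case True
      then show ?thesis using left[of x] that 1 by (simp add: mult_less_0_iff)
    next
      case False
      then show ?thesis using right[of x] that 1 by (simp add: mult_less_0_iff)
    qed
    then show ?thesis unfolding strict_local_extremum_def using e by blast
  next
    case 2
    have "f x > f (p i)" if "0 < \<bar>x - p i\<bar>" "\<bar>x - p i\<bar> < e" for x
    proof (cases "x < p i")
      case True
      then show ?thesis using left[of x] that 2 by (simp add: zero_less_mult_iff)
    next
      case False
      then show ?thesis using right[of x] that 2 by (simp add: zero_less_mult_iff)
    qed
    then show ?thesis unfolding strict_local_extremum_def using e by blast
  qed
qed

lemma partition_inside: "i \<in> {1..d} \<Longrightarrow> p i \<in> {a<..<b}"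
  using partition_less[of 0 i] partition_less[of i "Suc d"] partition_ends by auto

end

text \<open>A critical point of another partition is a strict local extremum, which cannot lie inside an affine
  piece of this one.\<close>

lemma critical_points_eq:
  assumes part: "affine_partition a b f d p s"
  shows "critical_points a b f = p ` {1..d}"
proof
  show "p ` {1..d} \<subseteq> critical_points a b f"
    using part unfolding critical_points_def by blast
  show "critical_points a b f \<subseteq> p ` {1..d}"
  proof
    fix c assume "c \<in> critical_points a b f"
    then obtain d' p' s' i where part': "affine_partition a b f d' p' s'" and i: "i \<in> {1..d'}" "c = p' i"
      unfolding critical_points_def by blast
    have ext: "strict_local_extremum f c" using partition_extremum[OF part'] i by simp
    have c: "a < c" "c < b" using partition_inside[OF part'] i by auto
    obtain j where j: "j \<le> d" "p j \<le> c" "c < p (Suc j)"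
      using partition_locate[OF part, of c] c by auto
    have "p j = c"
    proof (rule ccontr)
      assume "p j \<noteq> c"
      then show False
        using has_slope_not_extremum[OF partition_slope[OF part j(1)], of c] j ext by auto
    qed
    have "j \<noteq> 0"
    proof
      assume "j = 0"
      then have "p j = a" using partition_ends[OF part] by simp
      then show False using \<open>p j = c\<close> c by simp
    qed
    then have "j \<in> {1..d}" using j(1) by simp
    then show "c \<in> p ` {1..d}" using \<open>p j = c\<close> by blast
  qed
qed

section \<open>Expansion\<close>

locale nonrenormalizable_expanding_map =
  fixes a b :: real and f :: "real \<Rightarrow> real"
  assumes ab: "a < b"
    and piecewise_affine: "piecewise_affine a b f"
    and eventually_expanding: "eventually_expanding a b f"
    and non_renormalizable: "non_renormalizable a b f"
begin

abbreviation C where "C \<equiv> critical_points a b f"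

lemma funpow_maps: "(f ^^ n) ` {a..b} \<subseteq> {a..b}"
proof (induction n)
  case (Suc n)
  have "f ` {a..b} \<subseteq> {a..b}" using piecewise_affine unfolding piecewise_affine_def by blast
  then show ?case using Suc by (auto simp: image_subset_iff)
qed simp

lemma funpow_in: "x \<in> {a..b} \<Longrightarrow> (f ^^ n) x \<in> {a..b}"
  using funpow_maps by blast

lemma f_in: "x \<in> {a..b} \<Longrightarrow> f x \<in> {a..b}"
  using funpow_in[of x 1] by simp

lemma continuous_funpow: "continuous_on {a..b} (f ^^ n)"
proof (induction n)
  case (Suc n)
  have "continuous_on {a..b} f" using piecewise_affine unfolding piecewise_affine_def by blast
  then have "continuous_on {a..b} (f \<circ> (f ^^ n))"
    using Suc funpow_maps by (intro continuous_on_compose) (auto intro: continuous_on_subset)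
  then show ?case by simp
qed (simp add: continuous_on_id)

lemma finite_critical: "finite C"
  and critical_inside: "C \<subseteq> {a<..<b}"
  and critical_extremum: "c \<in> C \<Longrightarrow> strict_local_extremum f c"
proof -
  obtain d p s where part: "affine_partition a b f d p s"
    using piecewise_affine unfolding piecewise_affine_def by blast
  then show "finite C" "C \<subseteq> {a<..<b}" "c \<in> C \<Longrightarrow> strict_local_extremum f c"
    using critical_points_eq[OF part] partition_inside[OF part] partition_extremum[OF part] by auto
qed

lemma slopes_off_critical:
  "\<exists>B. finite B \<and> 0 \<notin> B \<and> (\<forall>u v. a \<le> u \<and> u < v \<and> v \<le> b \<and> {u<..<v} \<inter> C = {} \<longrightarrow>
      (\<exists>\<beta>\<in>B. has_slope f \<beta> {u..v}))"
proof -
  obtain d p s where part: "affine_partition a b f d p s"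
    using piecewise_affine unfolding piecewise_affine_def by blast
  have nz: "s i \<noteq> 0" if "i \<le> d" for i
  proof (cases "d = 0")
    case True
    show ?thesis
    proof
      assume "s i = 0"
      then have "has_slope f 0 {a..b}"
        using partition_slope[OF part, of i] that True partition_ends[OF part] by simp
      then have const: "f y = f x" if "x \<in> {a..b}" "y \<in> {a..b}" for x y
      proof -
        have "f y - f x = 0 * (y - x)"
          using \<open>has_slope f 0 {a..b}\<close> that unfolding has_slope_def by blast
        then show ?thesis by simp
      qed
      obtain n where n: "n \<ge> 1"
        "\<And>x D. x \<in> {a..b} \<Longrightarrow> ((f ^^ n) has_real_derivative D) (at x within {a..b}) \<Longrightarrow> \<bar>D\<bar> > 1"
        using eventually_expanding unfolding eventually_expanding_def by blast
      obtain m where m: "n = Suc m" using n(1) by (cases n) auto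
      have "has_slope (f ^^ n) 0 {a..b}"
        unfolding has_slope_def m funpow_Suc_right
      proof (intro ballI)
        fix x y assume "x \<in> {a..b}" "y \<in> {a..b}"
        then have "f y = f x" by (rule const)
        then show "(f ^^ m \<circ> f) y - (f ^^ m \<circ> f) x = 0 * (y - x)" by simp
      qed
      then have "((f ^^ n) has_real_derivative 0) (at ((a + b) / 2) within {a..b})"
        using ab by (intro has_slope_derivative) auto
      then show False using n(2)[of "(a + b) / 2" 0] ab by auto
    qed
  next
    case False
    then have "(if i < d then s i * s (Suc i) else s (i - 1) * s i) < 0"
      using partition_slope_signs[OF part, of i] partition_slope_signs[OF part, of "i - 1"] that by auto
    then show ?thesis by (auto split: if_splits)
  qed
  show ?thesis
  proof (intro exI[of _ "s ` {..d}"] conjI allI impI)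
    show "0 \<notin> s ` {..d}" using nz by force
    fix u v assume "a \<le> u \<and> u < v \<and> v \<le> b \<and> {u<..<v} \<inter> C = {}"
    then obtain i where i: "i \<le> d" "{u..v} \<subseteq> {p i..p (Suc i)}"
      using partition_piece[OF part] critical_points_eq[OF part] by metis
    then show "\<exists>\<beta>\<in>s ` {..d}. has_slope f \<beta> {u..v}"
      using has_slope_subset[OF partition_slope[OF part]] by blast
  qed simp
qed

lemma piecewise_slopes_funpow:
  "\<exists>B. finite B \<and> 0 \<notin> B \<and> piecewise_slopes a b (f ^^ n) B"
proof (induction n)
  case 0
  show ?case
  proof (intro exI conjI)
    show "piecewise_slopes a b (f ^^ 0) {1}" by (rule piecewise_slopes_id)
  qed simp_all
next
  case (Suc n)
  then obtain B where B: "finite B" "0 \<notin> B" "piecewise_slopes a b (f ^^ n) B" by blast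
  obtain B' where B': "finite B'" "0 \<notin> B'" "\<forall>u v. a \<le> u \<and> u < v \<and> v \<le> b \<and> {u<..<v} \<inter> C = {} \<longrightarrow>
      (\<exists>\<beta>\<in>B'. has_slope f \<beta> {u..v})"
    using slopes_off_critical by blast
  have "piecewise_slopes a b f B'" unfolding piecewise_slopes_def
    using finite_critical B'(3) by (intro exI[of _ C]) blast
  then have "piecewise_slopes a b (f \<circ> f ^^ n) {y * x | x y. x \<in> B \<and> y \<in> B'}"
    by (rule piecewise_slopes_compose[OF funpow_maps B(3,2)])
  moreover have "finite {y * x | x y. x \<in> B \<and> y \<in> B'}"
    using finite_image_set2[of "\<lambda>x. x \<in> B" "\<lambda>y. y \<in> B'" "\<lambda>x y. y * x"] B(1) B'(1) by simp
  moreover have "0 \<notin> {y * x | x y. x \<in> B \<and> y \<in> B'}" using B(2) B'(2) by auto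
  ultimately show ?case unfolding funpow.simps(2) by blast
qed

text \<open>An iterate has only finitely many slopes, so that the pointwise expansion is uniform.\<close>

lemma uniform_expansion:
  obtains n L where "n \<ge> 1" "L > 1" "piecewise_slopes a b (f ^^ n) {\<beta>. L \<le> \<bar>\<beta>\<bar>}"
proof -
  obtain n where n: "n \<ge> 1"
    "\<And>x D. x \<in> {a..b} \<Longrightarrow> ((f ^^ n) has_real_derivative D) (at x within {a..b}) \<Longrightarrow> \<bar>D\<bar> > 1"
    using eventually_expanding unfolding eventually_expanding_def by blast
  obtain B where B: "finite B" "piecewise_slopes a b (f ^^ n) B"
    using piecewise_slopes_funpow by blast
  obtain S where S: "finite S"
    and slope: "\<And>u v. a \<le> u \<Longrightarrow> u < v \<Longrightarrow> v \<le> b \<Longrightarrow> {u<..<v} \<inter> S = {} \<Longrightarrow> \<exists>\<beta>\<in>B. has_slope (f ^^ n) \<beta> {u..v}"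
    using B(2) unfolding piecewise_slopes_def by blast
  \<comment> \<open>the element 2 stands in for the case that \<open>B\<close> has no slope of modulus above 1\<close>
  define L where "L = Min (insert 2 ((\<lambda>\<beta>. \<bar>\<beta>\<bar>) ` {\<beta>\<in>B. \<bar>\<beta>\<bar> > 1}))"
  have "L > 1" using B(1) by (auto simp: L_def)
  moreover have "\<exists>\<beta>\<in>{\<beta>. L \<le> \<bar>\<beta>\<bar>}. has_slope (f ^^ n) \<beta> {u..v}"
    if uv: "a \<le> u" "u < v" "v \<le> b" "{u<..<v} \<inter> S = {}" for u v
  proof -
    obtain \<beta> where \<beta>: "\<beta> \<in> B" "has_slope (f ^^ n) \<beta> {u..v}" using slope[OF uv] by blast
    have "\<bar>\<beta>\<bar> > 1"
      using n(2)[OF _ has_slope_derivative[OF \<beta>(2), of "(u + v) / 2"]] uv by auto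
    then have "L \<le> \<bar>\<beta>\<bar>" using \<beta>(1) B(1) by (auto simp: L_def)
    then show ?thesis using \<beta>(2) by blast
  qed
  then have "piecewise_slopes a b (f ^^ n) {\<beta>. L \<le> \<bar>\<beta>\<bar>}"
    unfolding piecewise_slopes_def using S by blast
  ultimately show thesis using that n(1) by blast
qed

lemma strongly_expanding_iterate:
  obtains k where "k \<ge> 1" "piecewise_slopes a b (f ^^ k) {\<beta>. M \<le> \<bar>\<beta>\<bar>}"
proof -
  obtain n L where n: "n \<ge> 1" "L > 1" and pw: "piecewise_slopes a b (f ^^ n) {\<beta>. L \<le> \<bar>\<beta>\<bar>}"
    using uniform_expansion .
  have pow: "piecewise_slopes a b (f ^^ (n * j)) {\<beta>. L ^ j \<le> \<bar>\<beta>\<bar>}" for j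
  proof (induction j)
    case 0
    have "piecewise_slopes a b (f ^^ 0) {\<beta>. L ^ 0 \<le> \<bar>\<beta>\<bar>}"
      by (rule piecewise_slopes_mono[OF piecewise_slopes_id]) simp
    then show ?case by (simp only: mult_0_right)
  next
    case (Suc j)
    have "0 \<notin> {\<beta>::real. L ^ j \<le> \<bar>\<beta>\<bar>}" using n(2) by (simp add: not_le)
    then have "piecewise_slopes a b (f ^^ n \<circ> f ^^ (n * j)) {y * x |x y. x \<in> {\<beta>. L ^ j \<le> \<bar>\<beta>\<bar>} \<and> y \<in> {\<beta>. L \<le> \<bar>\<beta>\<bar>}}"
      by (intro piecewise_slopes_compose[OF funpow_maps Suc] pw)
    moreover have "{y * x |x y. x \<in> {\<beta>. L ^ j \<le> \<bar>\<beta>\<bar>} \<and> y \<in> {\<beta>. L \<le> \<bar>\<beta>\<bar>}} \<subseteq> {\<beta>. L ^ Suc j \<le> \<bar>\<beta>\<bar>}"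
      using n(2) by (auto simp: abs_mult intro!: mult_mono)
    ultimately have "piecewise_slopes a b (f ^^ n \<circ> f ^^ (n * j)) {\<beta>. L ^ Suc j \<le> \<bar>\<beta>\<bar>}"
      by (rule piecewise_slopes_mono)
    moreover have "f ^^ (n * Suc j) = f ^^ n \<circ> f ^^ (n * j)" by (simp add: funpow_add)
    ultimately show ?case by (simp only:)
  qed
  obtain j where j: "M < L ^ j" using n(2) real_arch_pow by blast
  have "L ^ j \<le> L ^ Suc j" using n(2) by (intro power_increasing) auto
  then have "{\<beta>. L ^ Suc j \<le> \<bar>\<beta>\<bar>} \<subseteq> {\<beta>. M \<le> \<bar>\<beta>\<bar>}" using j by auto
  then show thesis using that[of "n * Suc j"] n(1) piecewise_slopes_mono[OF pow[of "Suc j"]] by simp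
qed

text \<open>No interval is mapped affinely by all iterates, since its images would outgrow \<open>[a,b]\<close>.\<close>

lemma not_always_affine:
  assumes "a \<le> u" "u < v" "v \<le> b"
  obtains n where "\<And>\<beta>. \<not> has_slope (f ^^ n) \<beta> {u..v}"
proof -
  define M where "M = (b - a) / (v - u) + 1"
  obtain k where k: "piecewise_slopes a b (f ^^ k) {\<beta>. M \<le> \<bar>\<beta>\<bar>}" using strongly_expanding_iterate .
  have False if sl: "has_slope (f ^^ k) \<beta> {u..v}" for \<beta>
  proof -
    obtain S where S: "finite S"
      and slope: "\<And>u v. a \<le> u \<Longrightarrow> u < v \<Longrightarrow> v \<le> b \<Longrightarrow> {u<..<v} \<inter> S = {} \<Longrightarrow>
         \<exists>\<beta>\<in>{\<beta>. M \<le> \<bar>\<beta>\<bar>}. has_slope (f ^^ k) \<beta> {u..v}"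
      using k unfolding piecewise_slopes_def by blast
    obtain u' v' where uv': "u < u'" "u' < v'" "v' < v" "{u'..v'} \<inter> S = {}"
      using subinterval_avoiding_finite[OF S \<open>u < v\<close>] .
    have "{u'<..<v'} \<inter> S = {}" using uv'(4) by (force simp: disjoint_iff)
    then obtain \<gamma> where \<gamma>: "M \<le> \<bar>\<gamma>\<bar>" "has_slope (f ^^ k) \<gamma> {u'..v'}"
      using slope[of u' v'] uv' assms by auto
    have "has_slope (f ^^ k) \<beta> {u'..v'}" using sl uv' by (elim has_slope_subset) auto
    then have "\<gamma> = \<beta>" by (rule has_slope_unique[OF \<gamma>(2), of _ u' v']) (use uv' in auto)
    have "M * (v - u) = b - a + (v - u)" using assms by (simp add: M_def distrib_right)
    then have "b - a < M * (v - u)" using assms by simp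
    also have "\<dots> \<le> \<bar>\<beta>\<bar> * (v - u)" using \<gamma>(1) \<open>\<gamma> = \<beta>\<close> assms by (intro mult_right_mono) auto
    also have "\<dots> = \<bar>(f ^^ k) v - (f ^^ k) u\<bar>"
      using sl assms unfolding has_slope_def by (simp add: abs_mult)
    also have "\<dots> \<le> b - a"
      using funpow_in[of u k] funpow_in[of v k] assms by (auto simp: abs_le_iff)
    finally show False by simp
  qed
  then show thesis using that by blast
qed

end

section \<open>Growth of short intervals\<close>

lemma finite_separation:
  fixes S :: "real set"
  assumes "finite S"
  obtains e where "e > 0" "\<And>x y. x \<in> S \<Longrightarrow> y \<in> S \<Longrightarrow> \<bar>x - y\<bar> < e \<Longrightarrow> x = y"
proof
  let ?A = "(\<lambda>(x, y). \<bar>x - y\<bar>) ` {(x, y) \<in> S \<times> S. x \<noteq> y}"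
  have fin: "finite ?A" using assms
    by (intro finite_imageI) (auto intro: finite_subset[of _ "S \<times> S"])
  then show "Min (insert 1 ?A) > 0" by auto
  fix x y assume "x \<in> S" "y \<in> S" "\<bar>x - y\<bar> < Min (insert 1 ?A)"
  moreover have "Min (insert 1 ?A) \<le> \<bar>x - y\<bar>" if "x \<in> S" "y \<in> S" "x \<noteq> y"
    using fin that by (intro Min_le) auto
  ultimately show "x = y" by force
qed

lemma measure_Int_Icc_le: 
  assumes "E \<in> sets lebesgue" "u \<le> v"
  shows "measure lebesgue (E \<inter> {u..v}) \<le> v - u"
proof -
  have "measure lebesgue (E \<inter> {u..v}) \<le> measure lebesgue {u..v}"
    using assms by (intro measure_mono_fmeasurable) auto
  then show ?thesis using assms by simp
qed

lemma measure_Int_Icc_split: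
  assumes "E \<in> sets lebesgue" "u \<le> w" "w \<le> (v::real)"
  shows "measure lebesgue (E \<inter> {u..v}) \<le> measure lebesgue (E \<inter> {u..w}) + measure lebesgue (E \<inter> {w..v})"
proof -
  have "E \<inter> {u..v} = (E \<inter> {u..w}) \<union> (E \<inter> {w..v})" using assms by auto
  moreover have "E \<inter> {u..w} \<in> sets lebesgue" "E \<inter> {w..v} \<in> sets lebesgue"
    using assms(1) by auto
  ultimately show ?thesis by (simp only: measure_Un_le)
qed

context nonrenormalizable_expanding_map
begin

text \<open>A scale \<open>\<delta>\<close> such that a density bound only has to be verified on the intervals that some iterate
  maps affinely onto an interval of length at least \<open>\<delta>\<close>.\<close>

definition growth_scale :: "real \<Rightarrow> bool" where
  "growth_scale \<delta> \<longleftrightarrow> \<delta> > 0 \<and> (\<forall>E \<theta> u v. E \<in> sets lebesgue \<and> 0 \<le> \<theta> \<and> a \<le> u \<and> u \<le> v \<and> v \<le> b \<and>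
     (\<forall>u' v' m \<beta>. u \<le> u' \<and> u' < v' \<and> v' \<le> v \<and> has_slope (f ^^ m) \<beta> {u'..v'} \<and> \<delta> \<le> \<bar>\<beta>\<bar> * (v' - u') \<longrightarrow>
        measure lebesgue (E \<inter> {u'..v'}) \<le> \<theta> * (v' - u')) \<longrightarrow>
     measure lebesgue (E \<inter> {u..v}) \<le> \<theta> * (v - u))"

text \<open>Let \<open>F = f\<^sup>k\<close> have slopes of modulus at least 3, and let \<open>\<delta>\<close> be at most the distance
  between distinct break points of \<open>F\<close>. The image of an interval of length less than \<open>\<delta>\<close> under \<open>F\<close> breaks into at
  most two affine pieces. Iterating, after \<open>n\<close> steps the points that have not yet been in a piece of
  length \<open>\<delta>\<close> lie in at most \<open>2\<^sup>n\<close> intervals of length at most \<open>\<delta> / 3\<^sup>n\<close>, hence have measure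
  at most \<open>(2/3)\<^sup>n \<delta>\<close>.\<close>

lemma growth_scale_exists: "\<exists>\<delta>. growth_scale \<delta>"
proof -
  obtain k where k: "piecewise_slopes a b (f ^^ k) {\<beta>. 3 \<le> \<bar>\<beta>\<bar>}"
    using strongly_expanding_iterate .
  obtain S where S: "finite S"
    and slope: "\<And>u v. a \<le> u \<Longrightarrow> u < v \<Longrightarrow> v \<le> b \<Longrightarrow> {u<..<v} \<inter> S = {} \<Longrightarrow>
       \<exists>\<beta>\<in>{\<beta>. 3 \<le> \<bar>\<beta>\<bar>}. has_slope (f ^^ k) \<beta> {u..v}"
    using k unfolding piecewise_slopes_def by blast
  obtain \<delta> where \<delta>: "\<delta> > 0" "\<And>x y. x \<in> S \<Longrightarrow> y \<in> S \<Longrightarrow> \<bar>x - y\<bar> < \<delta> \<Longrightarrow> x = y"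
    using finite_separation[OF S] by blast
  have "measure lebesgue (E \<inter> {u..v}) \<le> \<theta> * (v - u)"
    if E: "E \<in> sets lebesgue" and \<theta>: "0 \<le> \<theta>" and uv: "a \<le> u" "u \<le> v" "v \<le> b"
      and large: "\<forall>u' v' m \<beta>. u \<le> u' \<and> u' < v' \<and> v' \<le> v \<and> has_slope (f ^^ m) \<beta> {u'..v'} \<and>
         \<delta> \<le> \<bar>\<beta>\<bar> * (v' - u') \<longrightarrow> measure lebesgue (E \<inter> {u'..v'}) \<le> \<theta> * (v' - u')"
    for E \<theta> u v
  proof -
    let ?\<mu> = "\<lambda>x y. measure lebesgue (E \<inter> {x..y})"
    have bound: "?\<mu> x y \<le> \<theta> * (y - x) + (2/3) ^ n * (\<delta> / \<bar>\<beta>\<bar>)"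
      if "u \<le> x" "x \<le> y" "y \<le> v" "has_slope (f ^^ m) \<beta> {x..y}" "\<beta> \<noteq> 0" for n x y m \<beta>
      using that
    proof (induction n arbitrary: x y m \<beta>)
      case 0
      show ?case
      proof (cases "x < y \<and> \<delta> \<le> \<bar>\<beta>\<bar> * (y - x)")
        case True
        then have "?\<mu> x y \<le> \<theta> * (y - x)" using large 0 by blast
        moreover have "0 \<le> \<delta> / \<bar>\<beta>\<bar>" using \<delta>(1) by simp
        ultimately show ?thesis unfolding power_0 mult_1_left by linarith
      next
        case False
        then have "\<bar>\<beta>\<bar> * (y - x) \<le> \<delta>" using 0(2) \<delta>(1) by (cases "x = y") auto
        then have "y - x \<le> \<delta> / \<bar>\<beta>\<bar>" using 0(5) by (simp add: field_simps)
        moreover have "0 \<le> \<theta> * (y - x)" using \<theta> 0(2) by simp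
        ultimately show ?thesis using measure_Int_Icc_le[OF E 0(2)] by simp
      qed
    next
      case (Suc n)
      define r where "r = (2/3) ^ n * (\<delta> / \<bar>\<beta>\<bar>) / 3"
      have r: "0 \<le> r" using \<delta>(1) by (simp add: r_def)
      have r2: "(2/3) ^ Suc n * (\<delta> / \<bar>\<beta>\<bar>) = 2 * r" by (simp add: r_def)
      \<comment> \<open>on a piece without break points the hypothesis applies with a slope at least three times
          as large; as there are at most two pieces, the factor 2/3 results\<close>
      have piece: "?\<mu> x' y' \<le> \<theta> * (y' - x') + r"
        if x'y': "x \<le> x'" "x' < y'" "y' \<le> y" "(f ^^ m) ` {x'<..<y'} \<inter> S = {}" for x' y'
      proof -
        have sl: "has_slope (f ^^ m) \<beta> {x'..y'}"
          by (rule has_slope_subset[OF Suc.prems(4)]) (use x'y' in auto)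
        obtain p q where pq: "(f ^^ m) ` {x'..y'} = {p..q}" "q - p = \<bar>\<beta>\<bar> * (y' - x')"
          using has_slope_image_Icc[OF sl] x'y'(2) by (metis less_imp_le)
        have "0 < \<bar>\<beta>\<bar> * (y' - x')" using x'y'(2) Suc.prems(5) by simp
        then have "p < q" using pq(2) by simp
        obtain x'' y'' where x''y'': "{x''..y''} \<subseteq> {x'..y'}" "x'' < y''" "(f ^^ m) ` {x''<..<y''} = {p<..<q}"
          using has_slope_preimage_Icc[OF sl Suc.prems(5) \<open>p < q\<close>] pq(1) by (metis order_refl)
        have "{x''<..<y''} \<subseteq> {x'<..<y'}" using x''y''(1,2) by auto
        then have "{p<..<q} \<inter> S = {}" using x'y'(4) x''y''(3) by blast
        moreover have "{p..q} \<subseteq> {a..b}"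
          unfolding pq(1)[symmetric] using x'y' uv Suc.prems by (intro image_subsetI funpow_in) auto
        ultimately obtain \<gamma> where \<gamma>: "3 \<le> \<bar>\<gamma>\<bar>" "has_slope (f ^^ k) \<gamma> {p..q}"
          using slope[of p q] \<open>p < q\<close> by auto
        have "has_slope (f ^^ (k + m)) (\<gamma> * \<beta>) {x'..y'}"
          using has_slope_funpow_add[OF sl] \<gamma>(2) pq(1) by simp
        then have "?\<mu> x' y' \<le> \<theta> * (y' - x') + (2/3) ^ n * (\<delta> / \<bar>\<gamma> * \<beta>\<bar>)"
          using x'y' Suc.prems \<gamma>(1) by (intro Suc.IH) auto
        moreover have "(2/3) ^ n * (\<delta> / \<bar>\<gamma> * \<beta>\<bar>) \<le> (2/3) ^ n * (\<delta> / (3 * \<bar>\<beta>\<bar>))"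
          unfolding abs_mult using \<gamma>(1) Suc.prems(5) \<delta>(1)
          by (intro divide_left_mono mult_left_mono mult_right_mono) auto
        moreover have "(2/3) ^ n * (\<delta> / (3 * \<bar>\<beta>\<bar>)) = r" by (simp add: r_def)
        ultimately show ?thesis by linarith
      qed
      show ?case
      proof (cases "x < y")
        case False
        then show ?thesis using measure_Int_Icc_le[OF E Suc.prems(2)] Suc.prems(2) r r2 by simp
      next
        case True
        show ?thesis
        proof (cases "\<delta> \<le> \<bar>\<beta>\<bar> * (y - x)")
          case True
          then have "?\<mu> x y \<le> \<theta> * (y - x)" using large Suc.prems \<open>x < y\<close> by blast
          then show ?thesis using r r2 by simp
        next
          case False
          show ?thesis
          proof (cases "(f ^^ m) ` {x<..<y} \<inter> S = {}")
            case True
            then have "?\<mu> x y \<le> \<theta> * (y - x) + r" using piece \<open>x < y\<close> by simp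
            then show ?thesis using r r2 by simp
          next
            case False
            then obtain w where w: "w \<in> {x<..<y}" "(f ^^ m) w \<in> S" by blast
            have only: "z = w" if "z \<in> {x<..<y}" "(f ^^ m) z \<in> S" for z
            proof -
              have "(f ^^ m) z - (f ^^ m) w = \<beta> * (z - w)"
                using Suc.prems(4) w that unfolding has_slope_def by force
              then have "\<bar>(f ^^ m) z - (f ^^ m) w\<bar> = \<bar>\<beta>\<bar> * \<bar>z - w\<bar>" by (simp add: abs_mult)
              also have "\<dots> \<le> \<bar>\<beta>\<bar> * (y - x)" using w that by (intro mult_left_mono) auto
              also have "\<dots> < \<delta>" using \<open>\<not> \<delta> \<le> \<bar>\<beta>\<bar> * (y - x)\<close> by simp
              finally have "(f ^^ m) z = (f ^^ m) w" using \<delta>(2) w that by blast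
              then show "z = w"
                using has_slope_inj[OF Suc.prems(4,5)] w that by (auto dest!: inj_onD)
            qed
            have "(f ^^ m) z \<notin> S" if "z \<in> {x<..<y}" "z \<noteq> w" for z
              using only that by blast
            then have "(f ^^ m) ` {x<..<w} \<inter> S = {}" "(f ^^ m) ` {w<..<y} \<inter> S = {}"
              using w(1) by (auto simp: disjoint_iff)
            then have "?\<mu> x w \<le> \<theta> * (w - x) + r" "?\<mu> w y \<le> \<theta> * (y - w) + r"
              using w(1) by (simp_all add: piece)
            moreover have "?\<mu> x y \<le> ?\<mu> x w + ?\<mu> w y"
              using w by (intro measure_Int_Icc_split[OF E]) auto
            moreover have "\<theta> * (w - x) + \<theta> * (y - w) = \<theta> * (y - x)" by (simp add: algebra_simps)
            ultimately show ?thesis using r2 by linarith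
          qed
        qed
      qed
    qed
    have "?\<mu> u v \<le> \<theta> * (v - u) + (2/3) ^ n * \<delta>" for n
      using bound[OF order_refl uv(2) order_refl has_slope_funpow_0, of n] by simp
    moreover have "(\<lambda>n. \<theta> * (v - u) + (2/3) ^ n * \<delta>) \<longlonglongrightarrow> \<theta> * (v - u) + 0 * \<delta>"
      by (intro tendsto_intros LIMSEQ_power_zero) auto
    ultimately show ?thesis by (intro LIMSEQ_le_const) auto
  qed
  then show ?thesis unfolding growth_scale_def using \<delta>(1) by blast
qed

lemma large_affine_image:
  assumes "growth_scale \<delta>" "a \<le> u" "u < v" "v \<le> b"
  obtains u' v' m \<beta> where "u \<le> u'" "u' < v'" "v' \<le> v" "has_slope (f ^^ m) \<beta> {u'..v'}"
    "\<delta> \<le> \<bar>\<beta>\<bar> * (v' - u')"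
proof (rule ccontr)
  assume "\<not> thesis"
  then have "\<forall>u' v' m \<beta>. u \<le> u' \<and> u' < v' \<and> v' \<le> v \<and> has_slope (f ^^ m) \<beta> {u'..v'} \<and> \<delta> \<le> \<bar>\<beta>\<bar> * (v' - u') \<longrightarrow>
        measure lebesgue (UNIV \<inter> {u'..v'}) \<le> 0 * (v' - u')"
    using that by blast
  then have "measure lebesgue (UNIV \<inter> {u..v}) \<le> 0 * (v - u)"
    using assms(1)[unfolded growth_scale_def, THEN conjunct2, rule_format, of UNIV 0 u v] assms(2-) by simp
  then show False using assms(3) by simp
qed

definition is_grid :: "real \<Rightarrow> (real \<times> real) set \<Rightarrow> bool" where
  "is_grid \<delta> J \<longleftrightarrow> finite J \<and> (\<forall>p q. (p, q) \<in> J \<longrightarrow> a \<le> p \<and> p < q \<and> q \<le> b) \<and>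
     (\<forall>u v. a \<le> u \<and> v \<le> b \<and> \<delta> \<le> v - u \<longrightarrow> (\<exists>p q. (p, q) \<in> J \<and> u \<le> p \<and> q \<le> v))"

lemma grid_exists:
  assumes "growth_scale \<delta>"
  shows "\<exists>J. is_grid \<delta> J"
proof -
  have "\<delta> > 0" using assms unfolding growth_scale_def by blast
  obtain N :: nat where N: "2 * (b - a) / \<delta> < real N" using reals_Archimedean2 by blast
  have "0 < 2 * (b - a) / \<delta>" using ab \<open>\<delta> > 0\<close> by simp
  then have N0: "0 < real N" using N by linarith
  define h where "h = (b - a) / real N"
  have h: "h > 0" "real N * h = b - a" using ab N0 by (auto simp: h_def)
  have h2: "2 * h < \<delta>" using N N0 \<open>\<delta> > 0\<close> by (simp add: h_def field_simps)
  let ?J = "(\<lambda>i. (a + real i * h, a + real (Suc i) * h)) ` {..<N}"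
  show ?thesis
    unfolding is_grid_def
  proof (rule exI[of _ ?J], intro conjI)
    show "finite ?J" by simp
  next
    show "\<forall>p q. (p, q) \<in> ?J \<longrightarrow> a \<le> p \<and> p < q \<and> q \<le> b"
    proof (intro allI impI)
      fix p q assume "(p, q) \<in> ?J"
      then obtain i where i: "i < N" "p = a + real i * h" "q = a + real (Suc i) * h" by blast
      have "real (Suc i) * h \<le> real N * h" using i(1) h by (intro mult_right_mono) auto
      moreover have "p < q" using i h by (simp add: distrib_right)
      moreover have "0 \<le> real i * h" using h by simp
      ultimately show "a \<le> p \<and> p < q \<and> q \<le> b" using i h(2) by auto
    qed
  next
    show "\<forall>u v. a \<le> u \<and> v \<le> b \<and> \<delta> \<le> v - u \<longrightarrow> (\<exists>p q. (p, q) \<in> ?J \<and> u \<le> p \<and> q \<le> v)"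
    proof (intro allI impI)
      fix u v assume "a \<le> u \<and> v \<le> b \<and> \<delta> \<le> v - u"
      then have uv: "a \<le> u" "v \<le> b" "\<delta> \<le> v - u" by auto
      define i where "i = nat \<lceil>(u - a) / h\<rceil>"
      have i: "(u - a) / h \<le> real i" "real i < (u - a) / h + 1"
        using uv h by (auto simp: i_def) linarith+
      have lo: "u \<le> a + real i * h" using i(1) h by (simp add: field_simps)
      have "real i * h < ((u - a) / h + 1) * h" using i(2) h by (intro mult_strict_right_mono) auto
      also have "\<dots> = u - a + h" using h by (simp add: distrib_right)
      finally have hi: "a + real (Suc i) * h \<le> v" using h2 uv by (simp add: distrib_right)
      have "real (Suc i) * h \<le> real N * h" using hi uv h(2) by linarith
      then have "real (Suc i) \<le> real N" using h(1) by simp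
      then have "i < N" by linarith
      then show "\<exists>p q. (p, q) \<in> ?J \<and> u \<le> p \<and> q \<le> v" using lo hi by blast
    qed
  qed
qed

text \<open>The finitely many intervals \<open>[p,q]\<close> with \<open>(p,q) \<in> J\<close> represent all intervals, up to affine
  iterates of \<open>f\<close>.\<close>

lemma affine_onto_grid:
  assumes \<delta>: "growth_scale \<delta>"
    and grid: "is_grid \<delta> J"
    and uv: "a \<le> u" "u < v" "v \<le> b"
  obtains p q u' v' m \<beta> where "(p, q) \<in> J" "u \<le> u'" "u' < v'" "v' \<le> v"
    "\<beta> \<noteq> 0" "has_slope (f ^^ m) \<beta> {u'..v'}" "(f ^^ m) ` {u'..v'} = {p..q}"
proof -
  obtain u1 v1 m \<beta> where 1: "u \<le> u1" "u1 < v1" "v1 \<le> v" "has_slope (f ^^ m) \<beta> {u1..v1}"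
    "\<delta> \<le> \<bar>\<beta>\<bar> * (v1 - u1)" using large_affine_image[OF \<delta> uv] .
  have "\<beta> \<noteq> 0" using 1(5) \<delta> unfolding growth_scale_def by auto
  obtain s t where st: "(f ^^ m) ` {u1..v1} = {s..t}" "t - s = \<bar>\<beta>\<bar> * (v1 - u1)"
    using has_slope_image_Icc[OF 1(4)] 1(2) by (metis less_imp_le)
  have "{s..t} \<subseteq> {a..b}"
    unfolding st(1)[symmetric] using 1 uv by (intro image_subsetI funpow_in) auto
  moreover have "s < t" using st(2) 1(2) \<open>\<beta> \<noteq> 0\<close> by (smt (verit) mult_pos_pos zero_less_abs_iff)
  ultimately have "a \<le> s \<and> t \<le> b \<and> \<delta> \<le> t - s" using st(2) 1(5) by simp
  then obtain p q where pq: "(p, q) \<in> J" "s \<le> p" "q \<le> t"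
    using grid unfolding is_grid_def by blast
  have "p < q" using grid pq(1) unfolding is_grid_def by blast
  have "{p..q} \<subseteq> (f ^^ m) ` {u1..v1}" using st pq by auto
  then obtain u' v' where uv': "{u'..v'} \<subseteq> {u1..v1}" "u' < v'" "(f ^^ m) ` {u'..v'} = {p..q}"
    using has_slope_preimage_Icc[OF 1(4) \<open>\<beta> \<noteq> 0\<close> \<open>p < q\<close>] by metis
  show thesis
  proof (rule that[OF pq(1)])
    show "has_slope (f ^^ m) \<beta> {u'..v'}" by (rule has_slope_subset[OF 1(4) uv'(1)])
  qed (use uv' 1 \<open>\<beta> \<noteq> 0\<close> in auto)
qed

end

section \<open>Density of noncritical preorbits\<close>

lemma open_interval_Ioo:
  fixes G :: "real set"
  assumes "open G" "is_interval G" "bounded G" "G \<noteq> {}"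
  obtains s t where "s < t" "G = {s<..<t}" "closure G = {s..t}"
proof -
  have "compact (closure G)" using assms(3) by (simp add: compact_closure)
  moreover have "connected (closure G)"
    using assms(2) by (simp add: connected_imp_connected_closure is_interval_connected_1)
  ultimately obtain s t where st: "closure G = {s..t}" using connected_compact_interval_1[of "closure G"] by blast
  have "interior (closure G) = G"
    using convex_interior_closure[of G] assms(1,2) by (simp add: is_interval_convex interior_open)
  then have "G = {s<..<t}" using st by simp
  moreover have "s < t" using \<open>G = {s<..<t}\<close> assms(4) by force
  ultimately show thesis using that st by blast
qed

context nonrenormalizable_expanding_map
begin

text \<open>The points at which some iterate of \<open>f\<close> takes the value \<open>y\<close> as a local homeomorphism.\<close>

definition noncritical_preorbit :: "real \<Rightarrow> real set" where
  "noncritical_preorbit y =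
     {x \<in> {a<..<b}. \<exists>n. (f ^^ n) x = y \<and> (\<forall>i<n. (f ^^ i) x \<in> {a<..<b} - C)}"

lemma noncritical_preorbit_refl: "y \<in> {a<..<b} \<Longrightarrow> y \<in> noncritical_preorbit y"
  unfolding noncritical_preorbit_def by (auto intro!: exI[of _ 0])

lemma noncritical_preorbit_step:
  assumes "z \<in> {a<..<b} - C" "f z \<in> noncritical_preorbit y"
  shows "z \<in> noncritical_preorbit y"
proof -
  obtain n where n: "(f ^^ n) (f z) = y" "\<forall>i<n. (f ^^ i) (f z) \<in> {a<..<b} - C"
    using assms(2) unfolding noncritical_preorbit_def by blast
  have "(f ^^ Suc n) z = y" using n(1) by (simp add: funpow_swap1)
  moreover have "(f ^^ i) z \<in> {a<..<b} - C" if "i < Suc n" for i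
    using that assms(1) n(2) by (cases i) (auto simp: funpow_swap1)
  ultimately show ?thesis using assms(1) unfolding noncritical_preorbit_def by blast
qed

text \<open>An interval that misses the preorbit of \<open>y\<close> cannot cross it one step later: a crossing value is
  also taken at a noncritical point.\<close>

lemma interior_image_misses_preorbit:
  assumes G: "is_interval G" "G \<subseteq> {a<..<b}" and miss: "G \<inter> noncritical_preorbit y = {}"
  shows "interior (f ` G) \<inter> noncritical_preorbit y = {}"
proof (rule ccontr)
  assume "\<not> ?thesis"
  then obtain w where w: "w \<in> interior (f ` G)" "w \<in> noncritical_preorbit y" by blast
  then obtain e where e: "e > 0" "ball w e \<subseteq> f ` G" by (meson mem_interior)
  have "w - e/2 \<in> f ` G" "w + e/2 \<in> f ` G" using e by (auto simp: subset_iff dist_real_def)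
  then obtain s t where st: "s \<in> G" "t \<in> G" "f s = w - e/2" "f t = w + e/2" by (metis imageE)
  have "s \<noteq> t" using st e by auto
  define u v where "u = min s t" and "v = max s t"
  have uv: "u < v" "f u < w \<and> w < f v \<or> f v < w \<and> w < f u" "u \<in> G" "v \<in> G"
    using st e \<open>s \<noteq> t\<close> by (auto simp: u_def v_def min_def max_def)
  have sub: "{u..v} \<subseteq> G"
    using mem_is_interval_1_I[OF G(1) uv(3,4)] by (simp add: subset_iff)
  have "continuous_on {u..v} f"
    using continuous_funpow[of 1] sub G(2) by (auto intro!: continuous_on_subset[of "{a..b}" f])
  then obtain z where z: "z \<in> {u<..<v}" "f z = w" "\<not> strict_local_extremum f z"
    using transversal_crossing[OF _ uv(1,2)] by blast
  have "z \<in> G" using z(1) sub by auto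
  moreover have "z \<notin> C" using z(3) critical_extremum by blast
  ultimately have "z \<in> noncritical_preorbit y"
    using noncritical_preorbit_step[of z y] G(2) w(2) z(2) by auto
  then show False using \<open>z \<in> G\<close> miss by blast
qed

text \<open>If the preorbit of \<open>y\<close> were not dense, then \<open>f\<close> would map the gaps of its closure into each other,
  up to boundary points. By expansion every sequence of gaps passes through the finitely many gaps that
  contain a critical point again and again, so some gap returns to itself; its closure is a
  renormalization.\<close>

lemma noncritical_preorbit_dense:
  assumes y: "y \<in> {a<..<b}" and uv: "a \<le> u" "u < v" "v \<le> b"
  shows "noncritical_preorbit y \<inter> {u<..<v} \<noteq> {}"
proof (rule ccontr)
  let ?P = "noncritical_preorbit y"
  assume "\<not> ?thesis"
  then have missing: "?P \<inter> {u<..<v} = {}" by blast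
  define Gap where "Gap = {a<..<b} - closure ?P"
  have "open Gap" unfolding Gap_def by (intro open_Diff) auto
  have gap: "open G" "is_interval G" "G \<subseteq> {a<..<b}" "G \<inter> ?P = {}" "G \<noteq> {}"
    if "G \<in> components Gap" for G
  proof -
    show "open G" using that \<open>open Gap\<close> by (rule open_components[rotated])
    show "is_interval G" using that in_components_connected is_interval_connected_1 by blast
    have "G \<subseteq> Gap" using that by (rule in_components_subset)
    then show "G \<subseteq> {a<..<b}" "G \<inter> ?P = {}" using closure_subset unfolding Gap_def by blast+
    show "G \<noteq> {}" using that by (rule in_components_nonempty)
  qed
  \<comment> \<open>the image of a gap is an interval whose interior misses the preorbit, so that it cannot leave a
      single gap except at its end points\<close>
  have "\<exists>G'\<in>components Gap. f ` closure G \<subseteq> closure G'" if G: "G \<in> components Gap" for G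
  proof -
    note g = gap[OF G]
    obtain x where "x \<in> G" using g(5) by blast
    obtain e where e: "e > 0" "cball x e \<subseteq> G" using g(1) \<open>x \<in> G\<close> open_contains_cball by blast
    have contf: "continuous_on (closure G) f"
    proof -
      have "closure G \<subseteq> {a..b}" using g(3) by (intro closure_minimal) auto
      then show ?thesis using continuous_funpow[of 1] by (auto intro: continuous_on_subset)
    qed
    have int: "is_interval (f ` G)"
      using contf g(2) closure_subset[of G]
      by (metis connected_continuous_image continuous_on_subset is_interval_connected_1)
    have "interior (f ` G) \<noteq> {}"
    proof -
      obtain s t where st: "x - e < s" "s < t" "t < x + e" "{s..t} \<inter> C = {}"
        using subinterval_avoiding_finite[OF finite_critical, of "x - e" "x + e"] e(1) by auto
      have sub: "{s..t} \<subseteq> G" using e(2) st by (force simp: dist_real_def subset_iff)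
      obtain B where B: "0 \<notin> B" "\<forall>u v. a \<le> u \<and> u < v \<and> v \<le> b \<and> {u<..<v} \<inter> C = {} \<longrightarrow>
          (\<exists>\<beta>\<in>B. has_slope f \<beta> {u..v})" using slopes_off_critical by blast
      have "s \<in> {s..t}" "t \<in> {s..t}" using st by auto
      then have "s \<in> {a<..<b}" "t \<in> {a<..<b}" using sub g(3) by blast+
      then have "a < s" "t < b" by auto
      moreover have "{s<..<t} \<inter> C = {}" using st(4) by (force simp: disjoint_iff)
      ultimately obtain \<beta> where \<beta>: "\<beta> \<in> B" "has_slope f \<beta> {s..t}" using B(2) st(2) by (meson less_imp_le)
      obtain p q where pq: "f ` {s..t} = {p..q}" "q - p = \<bar>\<beta>\<bar> * (t - s)"
        using has_slope_image_Icc[OF \<beta>(2)] st(2) by (metis less_imp_le)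
      have "\<beta> \<noteq> 0" using \<beta>(1) B(1) by blast
      then have "0 < \<bar>\<beta>\<bar> * (t - s)" using st(2) by simp
      then have "p < q" using pq(2) by simp
      have "{p..q} \<subseteq> f ` G" using image_mono[OF sub, of f] pq(1) by simp
      then have "{p<..<q} \<subseteq> interior (f ` G)"
        by (intro interior_maximal) (auto intro: subsetD)
      then show ?thesis using \<open>p < q\<close> by (metis dense empty_iff greaterThanLessThan_iff subsetD)
    qed
    moreover have "interior (f ` G) \<subseteq> Gap"
    proof -
      have "f ` G \<subseteq> {a..b}" using g(3) f_in by (force simp: image_subset_iff)
      then have "interior (f ` G) \<subseteq> {a<..<b}" using interior_mono interior_atLeastAtMost_real by blast
      moreover have "interior (f ` G) \<inter> closure ?P = {}"
        using interior_image_misses_preorbit[OF g(2,3,4)] by (simp add: open_Int_closure_eq_empty)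
      ultimately show ?thesis unfolding Gap_def by blast
    qed
    moreover have "connected (interior (f ` G))"
      using int by (intro convex_connected convex_interior) (simp add: is_interval_convex)
    ultimately obtain G' where G': "G' \<in> components Gap" "interior (f ` G) \<subseteq> G'"
      using exists_component_superset by blast
    have "f ` G \<subseteq> closure (interior (f ` G))"
      using convex_closure_interior[of "f ` G"] int \<open>interior (f ` G) \<noteq> {}\<close> closure_subset
      by (metis is_interval_convex)
    also have "\<dots> \<subseteq> closure G'" using G'(2) by (rule closure_mono)
    finally have "f ` closure G \<subseteq> closure G'"
      by (intro image_closure_subset[OF contf]) auto
    then show ?thesis using G'(1) by blast
  qed
  then obtain \<sigma> where \<sigma>: "\<And>G. G \<in> components Gap \<Longrightarrow> \<sigma> G \<in> components Gap"
    "\<And>G. G \<in> components Gap \<Longrightarrow> f ` closure G \<subseteq> closure (\<sigma> G)" by metis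
  have \<sigma>n: "(\<sigma> ^^ n) G \<in> components Gap \<and> (f ^^ n) ` closure G \<subseteq> closure ((\<sigma> ^^ n) G)"
    if "G \<in> components Gap" for n G
  proof (induction n)
    case (Suc n)
    have "(f ^^ Suc n) ` closure G = f ` ((f ^^ n) ` closure G)" by (simp add: image_image)
    also have "\<dots> \<subseteq> f ` closure ((\<sigma> ^^ n) G)" using Suc by (intro image_mono) blast
    also have "\<dots> \<subseteq> closure (\<sigma> ((\<sigma> ^^ n) G))" using Suc \<sigma>(2) by blast
    finally show ?case using Suc \<sigma>(1) by simp
  qed (use that in simp)
  have Icc: "\<exists>s t. a \<le> s \<and> s < t \<and> t \<le> b \<and> closure G = {s..t} \<and> {s<..<t} \<subseteq> G" if G: "G \<in> components Gap" for G
  proof -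
    note g = gap[OF G]
    have "bounded G" using g(3) bounded_subset[of "{a<..<b}"] by auto
    then obtain s t where st: "s < t" "G = {s<..<t}" "closure G = {s..t}"
      using open_interval_Ioo[OF g(1,2) _ g(5)] by blast
    have "closure G \<subseteq> {a..b}" using g(3) by (intro closure_minimal) auto
    then have "a \<le> s" "t \<le> b" using st by auto
    then show ?thesis using st by blast
  qed
  have hits: "\<exists>j\<ge>i. (\<sigma> ^^ j) G \<inter> C \<noteq> {}" if G: "G \<in> components Gap" for G i
  proof (rule ccontr)
    assume "\<not> ?thesis"
    then have no: "(\<sigma> ^^ j) G \<inter> C = {}" if "j \<ge> i" for j using that by blast
    define H where "H = (\<sigma> ^^ i) G"
    have H: "H \<in> components Gap" using \<sigma>n[OF G] H_def by blast
    have noH: "(\<sigma> ^^ n) H \<inter> C = {}" for n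
      using no[of "n + i"] unfolding H_def by (simp add: funpow_add)
    obtain s t where st: "a \<le> s" "s < t" "t \<le> b" "closure H = {s..t}" using Icc[OF H] by blast
    have "\<exists>\<beta>. has_slope (f ^^ n) \<beta> {s..t}" for n
    proof (induction n)
      case 0
      then show ?case using has_slope_funpow_0 by blast
    next
      case (Suc n)
      then obtain \<beta> where \<beta>: "has_slope (f ^^ n) \<beta> {s..t}" by blast
      have Hn: "(\<sigma> ^^ n) H \<in> components Gap" "(f ^^ n) ` {s..t} \<subseteq> closure ((\<sigma> ^^ n) H)"
        using \<sigma>n[OF H, of n] st(4) by auto
      obtain p q where pq: "a \<le> p" "p < q" "q \<le> b" "closure ((\<sigma> ^^ n) H) = {p..q}" "{p<..<q} \<subseteq> (\<sigma> ^^ n) H"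
        using Icc[OF Hn(1)] by blast
      have "{p<..<q} \<inter> C = {}" using pq(5) noH[of n] by blast
      then obtain \<gamma> where "has_slope f \<gamma> {p..q}" using slopes_off_critical pq by metis
      then have "has_slope (f ^^ 1) \<gamma> ((f ^^ n) ` {s..t})"
        using Hn(2) pq(4) by (auto elim: has_slope_subset)
      then have "has_slope (f ^^ (1 + n)) (\<gamma> * \<beta>) {s..t}" using has_slope_funpow_add[OF \<beta>] by blast
      then show ?case unfolding plus_1_eq_Suc by blast
    qed
    then show False using not_always_affine[OF st(1-3)] by metis
  qed
  have "(u + v) / 2 \<in> Gap"
  proof -
    have "{u<..<v} \<inter> closure ?P = {}" using missing open_Int_closure_eq_empty[of "{u<..<v}" ?P] by (simp add: Int_commute)
    then show ?thesis using uv unfolding Gap_def by (auto simp: disjoint_iff)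
  qed
  then obtain G where G: "G \<in> components Gap" unfolding components_def by blast
  let ?Cgaps = "{H \<in> components Gap. H \<inter> C \<noteq> {}}"
  have "finite ?Cgaps"
  proof -
    have "?Cgaps \<subseteq> (\<lambda>c. connected_component_set Gap c) ` C"
    proof
      fix H assume H: "H \<in> ?Cgaps"
      then obtain c where c: "c \<in> H" "c \<in> C" by blast
      then have "H = connected_component_set Gap c"
        using H by (metis (no_types, lifting) components_iff connected_component_eq mem_Collect_eq)
      then show "H \<in> (\<lambda>c. connected_component_set Gap c) ` C" using c by blast
    qed
    then show ?thesis using finite_critical finite_subset by blast
  qed
  have "infinite {j. (\<sigma> ^^ j) G \<in> ?Cgaps}"
    unfolding infinite_nat_iff_unbounded_le using hits[OF G] \<sigma>n[OF G] by simp
  have "\<not> inj_on (\<lambda>j. (\<sigma> ^^ j) G) {j. (\<sigma> ^^ j) G \<in> ?Cgaps}"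
  proof
    assume "inj_on (\<lambda>j. (\<sigma> ^^ j) G) {j. (\<sigma> ^^ j) G \<in> ?Cgaps}"
    moreover have "finite ((\<lambda>j. (\<sigma> ^^ j) G) ` {j. (\<sigma> ^^ j) G \<in> ?Cgaps})"
      by (rule finite_subset[OF _ \<open>finite ?Cgaps\<close>]) (rule image_subsetI, rule CollectD)
    ultimately have "finite {j. (\<sigma> ^^ j) G \<in> ?Cgaps}" by (rule finite_imageD[rotated])
    then show False using \<open>infinite {j. (\<sigma> ^^ j) G \<in> ?Cgaps}\<close> by (rule notE[rotated])
  qed
  then obtain i j where ij: "i < j" "(\<sigma> ^^ i) G = (\<sigma> ^^ j) G"
    unfolding inj_on_def by (metis linorder_neqE_nat)
  define H where "H = (\<sigma> ^^ i) G"
  have H: "H \<in> components Gap" using \<sigma>n[OF G] H_def by blast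
  have "(\<sigma> ^^ (j - i)) H = (\<sigma> ^^ (j - i + i)) G" unfolding H_def by (simp only: funpow_add o_apply)
  then have "(\<sigma> ^^ (j - i)) H = H" using ij unfolding H_def by simp
  then have ex: "\<exists>n\<ge>1. (\<sigma> ^^ n) H = H" using ij by (intro exI[of _ "j - i"]) auto
  \<comment> \<open>minimality of the return time makes the gaps along the cycle distinct, hence disjoint\<close>
  define n where "n = (LEAST n. n \<ge> 1 \<and> (\<sigma> ^^ n) H = H)"
  have n: "n \<ge> 1" "(\<sigma> ^^ n) H = H" using LeastI_ex[OF ex] unfolding n_def by auto
  have minimal: "(\<sigma> ^^ m) H \<noteq> H" if "1 \<le> m" "m < n" for m
    using not_less_Least[of m "\<lambda>n. n \<ge> 1 \<and> (\<sigma> ^^ n) H = H"] that unfolding n_def by blast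
  have distinct: "(\<sigma> ^^ k) H \<noteq> (\<sigma> ^^ l) H" if kl: "k < l" "l < n" for k l
  proof
    assume eq: "(\<sigma> ^^ k) H = (\<sigma> ^^ l) H"
    have "(\<sigma> ^^ (n - l + k)) H = (\<sigma> ^^ (n - l)) ((\<sigma> ^^ l) H)"
      using eq by (simp only: funpow_add o_apply)
    also have "\<dots> = (\<sigma> ^^ (n - l + l)) H" by (simp only: funpow_add o_apply)
    also have "\<dots> = H" using kl n(2) by simp
    finally have "(\<sigma> ^^ (n - l + k)) H = H" .
    moreover have "1 \<le> n - l + k" "n - l + k < n" using kl by linarith+
    ultimately show False using minimal by blast
  qed
  have "renormalization a b f (closure H) n"
    unfolding renormalization_def
  proof (intro conjI)
    obtain s t where st: "a \<le> s" "s < t" "t \<le> b" "closure H = {s..t}" using Icc[OF H] by blast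
    show "proper_interval (closure H)"
      unfolding st(4) proper_interval_def
    proof (intro conjI bexI)
      show "is_interval {s..t}" by (rule is_interval_cc)
      show "s < t" by (rule st(2))
    qed (use st(2) in auto)
    show "closure H \<subseteq> {a..b}" using st by auto
    show "1 \<le> n" by (rule n(1))
    show "(f ^^ n) ` closure H \<subseteq> closure H" using \<sigma>n[OF H, of n] n(2) by simp
    have "interior (closure H) = H"
      using convex_interior_closure[of H] gap(1,2)[OF H] by (simp add: is_interval_convex interior_open)
    moreover have "y \<notin> H" using gap(4)[OF H] noncritical_preorbit_refl[OF y] by blast
    ultimately show "closure (closure H) \<noteq> {a..b}" using y by (auto simp: interior_atLeastAtMost_real)
    show "disjoint_family_on (\<lambda>i. interior ((f ^^ i) ` closure H)) {..<n}"
    proof -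
      have sub: "interior ((f ^^ i) ` closure H) \<subseteq> (\<sigma> ^^ i) H" for i
      proof -
        have Hi: "(\<sigma> ^^ i) H \<in> components Gap" using \<sigma>n[OF H] by blast
        have "interior (closure ((\<sigma> ^^ i) H)) = (\<sigma> ^^ i) H"
          using convex_interior_closure[of "(\<sigma> ^^ i) H"] gap(1,2)[OF Hi]
          by (simp add: is_interval_convex interior_open)
        then show ?thesis using interior_mono \<sigma>n[OF H, of i] by blast
      qed
      have "(\<sigma> ^^ k) H \<inter> (\<sigma> ^^ l) H = {}" if "k < n" "l < n" "k \<noteq> l" for k l
      proof -
        have "(\<sigma> ^^ k) H \<noteq> (\<sigma> ^^ l) H"
          using that distinct[of k l] distinct[of l k] by (metis linorder_neqE_nat)
        then show ?thesis using \<sigma>n[OF H] components_nonoverlap by blast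
      qed
      then show ?thesis unfolding disjoint_family_on_def using sub by (meson disjoint_iff lessThan_iff subsetD)
    qed
  qed
  then show False using non_renormalizable unfolding non_renormalizable_def by blast
qed

section \<open>Small nice neighborhoods\<close>


lemma slope_off_critical:
  assumes "a \<le> u" "u < v" "v \<le> b" "{u<..<v} \<inter> C = {}"
  obtains \<beta> where "\<beta> \<noteq> 0" "has_slope f \<beta> {u..v}"
  using slopes_off_critical assms by metis

text \<open>Every grid interval contains an interval that some iterate maps affinely onto a grid interval; since
  the grid is finite, some grid interval is thus mapped over itself by an affine branch whose domain
  can be chosen away from \<open>X\<close>. That branch has a fixed point.\<close>

lemma periodic_point_avoiding:
  assumes X: "finite X"
  obtains z n where "z \<in> {a<..<b}" "z \<notin> X" "n \<ge> 1" "(f ^^ n) z = z"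
proof -
  obtain \<delta> where \<delta>: "growth_scale \<delta>" using growth_scale_exists by blast
  obtain J where grid: "is_grid \<delta> J" using grid_exists[OF \<delta>] by blast
  then have J: "finite J" "\<And>p q. (p, q) \<in> J \<Longrightarrow> a \<le> p \<and> p < q \<and> q \<le> b"
    unfolding is_grid_def by blast+
  define covers where "covers x y n \<longleftrightarrow> (\<exists>u v \<beta>. fst x < u \<and> u < v \<and> v < snd x \<and> {u..v} \<inter> X = {} \<and> \<beta> \<noteq> 0 \<and>
      has_slope (f ^^ n) \<beta> {u..v} \<and> (f ^^ n) ` {u..v} = {fst y..snd y})" for x y :: "real \<times> real" and n
  have trans: "covers x z (m + n)" if xy: "covers x y n" and yz: "covers y z m" for x y z m n
  proof -
    obtain u v \<beta> where 1: "fst x < u" "u < v" "v < snd x" "{u..v} \<inter> X = {}" "\<beta> \<noteq> 0"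
      "has_slope (f ^^ n) \<beta> {u..v}" "(f ^^ n) ` {u..v} = {fst y..snd y}"
      using xy unfolding covers_def by blast
    obtain s t \<gamma> where 2: "fst y < s" "s < t" "t < snd y" "\<gamma> \<noteq> 0"
      "has_slope (f ^^ m) \<gamma> {s..t}" "(f ^^ m) ` {s..t} = {fst z..snd z}"
      using yz unfolding covers_def by blast
    have "{s..t} \<subseteq> (f ^^ n) ` {u..v}" using 1(7) 2(1,3) by auto
    then obtain u' v' where uv': "{u'..v'} \<subseteq> {u..v}" "u' < v'" "(f ^^ n) ` {u'..v'} = {s..t}"
      using has_slope_preimage_Icc[OF 1(6,5) 2(2)] by metis
    have "has_slope (f ^^ (m + n)) (\<gamma> * \<beta>) {u'..v'}"
      using has_slope_subset[OF 1(6) uv'(1)] 2(5) unfolding uv'(3)[symmetric] by (rule has_slope_funpow_add)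
    moreover have "(f ^^ (m + n)) ` {u'..v'} = {fst z..snd z}"
      unfolding funpow_add image_comp[symmetric] uv'(3) by (rule 2(6))
    moreover have "{u'..v'} \<inter> X = {}" using 1(4) uv'(1) by blast
    moreover have "fst x < u'" "v' < snd x" using uv'(1,2) 1(1,3) by auto
    moreover have "\<gamma> * \<beta> \<noteq> 0" using 1(5) 2(4) by simp
    ultimately show ?thesis unfolding covers_def using uv'(2) by blast
  qed
  have "\<exists>y\<in>J. \<exists>n\<ge>1. covers x y n" if xJ: "x \<in> J" for x
  proof -
    define L where "L = Min ((\<lambda>(p, q). q - p) ` J)"
    have L: "L > 0" "\<And>p q. (p, q) \<in> J \<Longrightarrow> L \<le> q - p"
    proof -
      show "L > 0" unfolding L_def using J(1,2) xJ by (subst Min_gr_iff) auto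
      show "L \<le> q - p" if "(p, q) \<in> J" for p q
        unfolding L_def using J(1) that by (intro Min_le) auto
    qed
    have x: "a \<le> fst x" "fst x < snd x" "snd x \<le> b" using J(2)[of "fst x" "snd x"] xJ by auto
    obtain u1 v1 where 1: "fst x < u1" "u1 < v1" "v1 < snd x" "{u1..v1} \<inter> X = {}"
      using subinterval_avoiding_finite[OF X x(2)] .
    define v2 where "v2 = min v1 (u1 + L / 2)"
    have v2: "u1 < v2" "v2 \<le> v1" "v2 - u1 \<le> L / 2"
      using 1 L(1) unfolding v2_def by linarith+
    obtain p q u v m \<beta> where 2: "(p, q) \<in> J" "u1 \<le> u" "u < v" "v \<le> v2"
      "\<beta> \<noteq> 0" "has_slope (f ^^ m) \<beta> {u..v}" "(f ^^ m) ` {u..v} = {p..q}"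
    proof -
      have "a \<le> u1" "v2 \<le> b" using 1 v2 x by linarith+
      then show thesis using affine_onto_grid[OF \<delta> grid _ v2(1)] that by metis
    qed
    \<comment> \<open>the domain is shorter than every grid interval, so the time is positive\<close>
    have "m \<noteq> 0"
    proof
      assume "m = 0"
      then have "{u..v} = {p..q}" using 2(7) by simp
      then have "p = u" "q = v" using 2(3) by (auto simp: Icc_eq_Icc)
      then show False using L(2)[OF 2(1)] 2(2,4) v2(3) L(1) by linarith
    qed
    moreover have "{u..v} \<inter> X = {}"
    proof -
      have "{u..v} \<subseteq> {u1..v1}" using 2 v2 by auto
      then show ?thesis using 1(4) by blast
    qed
    moreover have "fst x < u" "v < snd x" using 1 2 v2 by auto
    ultimately have "covers x (p, q) m" unfolding covers_def fst_conv snd_conv using 2(3,5,6,7) by blast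
    moreover have "m \<ge> 1" using \<open>m \<noteq> 0\<close> by simp
    ultimately show ?thesis using 2(1) by blast
  qed
  then obtain \<sigma> where \<sigma>: "\<And>x. x \<in> J \<Longrightarrow> \<sigma> x \<in> J" "\<And>x. x \<in> J \<Longrightarrow> \<exists>n\<ge>1. covers x (\<sigma> x) n" by metis
  have \<sigma>n: "(\<sigma> ^^ k) x \<in> J" if "x \<in> J" for k x
    using that \<sigma>(1) by (induction k) auto
  have iter: "\<exists>n\<ge>1. covers x ((\<sigma> ^^ Suc k) x) n" if x: "x \<in> J" for k x
  proof (induction k)
    case 0
    then show ?case using \<sigma>(2) x by simp
  next
    case (Suc k)
    then obtain n where n: "n \<ge> 1" "covers x ((\<sigma> ^^ Suc k) x) n" by blast
    obtain m where "covers ((\<sigma> ^^ Suc k) x) (\<sigma> ((\<sigma> ^^ Suc k) x)) m" using \<sigma>(2) \<sigma>n[OF x] by blast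
    then have "covers x ((\<sigma> ^^ Suc (Suc k)) x) (m + n)" using trans[OF n(2)] by simp
    then show ?case using n(1) by (intro exI[of _ "m + n"]) auto
  qed
  obtain x0 where x0: "x0 \<in> J"
  proof -
    obtain p q where "(p, q) \<in> J"
      using affine_onto_grid[OF \<delta> grid order_refl ab order_refl] by metis
    then show thesis using that by blast
  qed
  have "\<not> inj_on (\<lambda>k. (\<sigma> ^^ k) x0) UNIV"
  proof
    assume "inj_on (\<lambda>k. (\<sigma> ^^ k) x0) UNIV"
    moreover have "range (\<lambda>k. (\<sigma> ^^ k) x0) \<subseteq> J" using \<sigma>n[OF x0] by blast
    ultimately show False using J(1) by (meson finite_imageD finite_subset infinite_UNIV_nat)
  qed
  then obtain i j where ij: "i < j" "(\<sigma> ^^ i) x0 = (\<sigma> ^^ j) x0"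
    unfolding inj_on_def by (metis linorder_neqE_nat)
  define x where "x = (\<sigma> ^^ i) x0"
  have xJ: "x \<in> J" using \<sigma>n[OF x0] x_def by simp
  obtain k where k: "j = Suc k + i" using ij(1) by (metis add.commute less_iff_Suc_add add_Suc)
  have "(\<sigma> ^^ Suc k) x = x" using ij(2) unfolding k x_def funpow_add by simp
  then obtain n where n: "n \<ge> 1" "covers x x n" using iter[OF xJ, of k] by metis
  obtain u v \<beta> where uv: "fst x < u" "u < v" "v < snd x" "{u..v} \<inter> X = {}"
      "has_slope (f ^^ n) \<beta> {u..v}" "(f ^^ n) ` {u..v} = {fst x..snd x}"
    using n(2) unfolding covers_def by blast
  let ?h = "\<lambda>t. (f ^^ n) t - t"
  have "fst x \<in> (f ^^ n) ` {u..v}" "snd x \<in> (f ^^ n) ` {u..v}" using uv by auto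
  then obtain s t where st: "s \<in> {u..v}" "(f ^^ n) s = fst x" "t \<in> {u..v}" "(f ^^ n) t = snd x"
    by (metis imageE)
  have "continuous_on {u..v} ?h" using has_slope_continuous[OF uv(5)] by (intro continuous_intros)
  then have "is_interval (?h ` {u..v})"
    by (metis connected_continuous_image connected_Icc is_interval_connected_1)
  moreover have "?h s \<in> ?h ` {u..v}" "?h t \<in> ?h ` {u..v}" using st by blast+
  moreover have "?h s \<le> 0" "0 \<le> ?h t" using st uv by auto
  ultimately have "0 \<in> ?h ` {u..v}" using mem_is_interval_1_I by blast
  then obtain z where z: "z \<in> {u..v}" "(f ^^ n) z = z" by auto
  moreover have "z \<in> {a<..<b}" using z(1) uv J(2)[of "fst x" "snd x"] xJ by auto
  moreover have "z \<notin> X" using z(1) uv(4) by blast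
  ultimately show thesis using that n(1) by blast
qed

text \<open>As soon as an orbit contains a periodic point, the whole orbit is finite.\<close>

lemma finite_periodic_points_of_orbit:
  "finite {x \<in> range (\<lambda>i. (f ^^ i) c). \<exists>n\<ge>1. (f ^^ n) x = x}" (is "finite ?X")
proof (cases "?X = {}")
  case False
  then obtain i n where n: "n \<ge> 1" "(f ^^ n) ((f ^^ i) c) = (f ^^ i) c" by blast
  have "(f ^^ k) c \<in> (\<lambda>k. (f ^^ k) c) ` {..<i + n}" for k
  proof (cases "k < i")
    case False
    have "(f ^^ k) c = (f ^^ (k - i)) ((f ^^ i) c)"
      using False by (metis comp_apply funpow_add le_add_diff_inverse2 not_less)
    also have "\<dots> = (f ^^ ((k - i) mod n)) ((f ^^ i) c)" using funpow_mod_eq[OF n(2)] by simp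
    also have "\<dots> = (f ^^ ((k - i) mod n + i)) c" by (simp add: funpow_add)
    finally show ?thesis using n(1) by (intro image_eqI) auto
  qed auto
  then have "?X \<subseteq> (\<lambda>k. (f ^^ k) c) ` {..<i + n}" by blast
  then show ?thesis by (rule finite_subset) simp
next
  case True
  then show ?thesis by (simp only: finite.emptyI)
qed

text \<open>Let \<open>Z\<close> be a periodic orbit that no critical orbit meets. The sets \<open>f\<^sup>-\<^sup>n(Z)\<close> are closed, forward
  invariant and miss \<open>C\<close>, and their union is dense since it contains a preorbit. So the gaps of
  \<open>f\<^sup>-\<^sup>n(Z)\<close> around the critical points form a nice neighborhood, which is small for large \<open>n\<close>.\<close>

lemma small_nice_neighborhood:
  assumes "\<epsilon> > 0"
  obtains U where "nice_neighborhood a b f U"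
    "\<And>c. c \<in> C \<Longrightarrow> connected_component_set U c \<subseteq> {c - \<epsilon><..<c + \<epsilon>}"
proof -
  define X where "X = (\<Union>c\<in>C. {x \<in> range (\<lambda>i. (f ^^ i) c). \<exists>n\<ge>1. (f ^^ n) x = x})"
  have "finite X" unfolding X_def using finite_critical finite_periodic_points_of_orbit by blast
  then obtain z m where z: "z \<in> {a<..<b}" "z \<notin> X" "m \<ge> 1" "(f ^^ m) z = z"
    using periodic_point_avoiding by blast
  define Z where "Z = (\<lambda>i. (f ^^ i) z) ` {..<m}"
  have Z: "(f ^^ i) z \<in> Z" for i
    unfolding Z_def using funpow_mod_eq[OF z(4), of i] z(3)
    by (intro image_eqI[of _ _ "i mod m"]) auto
  have fZ: "f w \<in> Z" if wZ: "w \<in> Z" for w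
  proof -
    obtain i where "w = (f ^^ i) z" using wZ unfolding Z_def by blast
    then show ?thesis using Z[of "Suc i"] by simp
  qed
  have avoid: "(f ^^ i) c \<notin> Z" if c: "c \<in> C" for i c
  proof
    assume "(f ^^ i) c \<in> Z"
    then obtain j where j: "j < m" "(f ^^ i) c = (f ^^ j) z" unfolding Z_def by blast
    have "(f ^^ (m - j + i)) c = (f ^^ (m - j)) ((f ^^ i) c)" by (simp add: funpow_add)
    also have "\<dots> = (f ^^ (m - j + j)) z" unfolding j(2) by (simp add: funpow_add)
    also have "\<dots> = z" using j(1) z(4) by simp
    finally have "z \<in> range (\<lambda>i. (f ^^ i) c)" by (metis rangeI)
    then show False using z c unfolding X_def by blast
  qed
  define Zn where "Zn n = {x \<in> {a..b}. (f ^^ n) x \<in> Z}" for n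
  have closed_Zn: "closed (Zn n)" for n
  proof -
    have "closed Z" unfolding Z_def by (intro finite_imp_closed) simp
    then have "closed ({a..b} \<inter> (f ^^ n) -` Z)"
      by (intro continuous_closed_preimage continuous_funpow) auto
    moreover have "{a..b} \<inter> (f ^^ n) -` Z = Zn n" by (auto simp: Zn_def)
    ultimately show ?thesis by simp
  qed
  have Zn_Suc: "Zn n \<subseteq> Zn (Suc n)" for n using fZ by (auto simp: Zn_def)
  have Zn_f: "f x \<in> Zn n" if x: "x \<in> Zn n" for n x
  proof -
    have "(f ^^ n) (f x) = f ((f ^^ n) x)" by (simp add: funpow_swap1)
    then show ?thesis using x fZ f_in unfolding Zn_def by simp
  qed
  have Zn_funpow: "(f ^^ i) x \<in> Zn n" if "x \<in> Zn n" for i n x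
    using that Zn_f by (induction i) auto
  have dense: "\<forall>\<^sub>F n in sequentially. Zn n \<inter> {s<..<t} \<noteq> {}" if st: "a \<le> s" "s < t" "t \<le> b" for s t
  proof -
    obtain x where x: "x \<in> noncritical_preorbit z" "x \<in> {s<..<t}"
      using noncritical_preorbit_dense[OF z(1) st] by blast
    then obtain n where "(f ^^ n) x = z" unfolding noncritical_preorbit_def by blast
    then have "x \<in> Zn n" using x(2) st Z[of 0] by (simp add: Zn_def)
    moreover have "Zn n \<subseteq> Zn k" if "n \<le> k" for k using lift_Suc_mono_le[of Zn n k] Zn_Suc that by blast
    ultimately show ?thesis unfolding eventually_sequentially using x(2) by blast
  qed
  obtain e where e: "e > 0" "\<And>x y. x \<in> insert a (insert b C) \<Longrightarrow> y \<in> insert a (insert b C) \<Longrightarrow> \<bar>x - y\<bar> < e \<Longrightarrow> x = y"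
    using finite_separation[of "insert a (insert b C)"] finite_critical by blast
  define r where "r = min \<epsilon> e"
  have r: "r > 0" "r \<le> \<epsilon>" "r \<le> e" using assms e(1) by (auto simp: r_def)
  have room: "a \<le> c - r" "c + r \<le> b" if c: "c \<in> C" for c
  proof -
    have "a < c" "c < b" using c critical_inside by auto
    then have "\<not> c - a < e" "\<not> b - c < e" using e(2)[of c a] e(2)[of b c] c by auto
    then show "a \<le> c - r" "c + r \<le> b" using r(3) by linarith+
  qed
  have "\<forall>\<^sub>F n in sequentially. \<forall>c\<in>C. Zn n \<inter> {c - r<..<c} \<noteq> {} \<and> Zn n \<inter> {c<..<c + r} \<noteq> {}"
  proof (intro eventually_ball_finite[OF finite_critical] ballI eventually_conj dense)
    fix c assume c: "c \<in> C"
    then have "c \<in> {a<..<b}" using critical_inside by blast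
    then show "c \<le> b" "a \<le> c" by auto
  qed (use r room in auto)
  then obtain n where n: "\<And>c. c \<in> C \<Longrightarrow> Zn n \<inter> {c - r<..<c} \<noteq> {} \<and> Zn n \<inter> {c<..<c + r} \<noteq> {}"
    unfolding eventually_sequentially by blast
  define G where "G = {a<..<b} - Zn n"
  define V where "V c = connected_component_set G c" for c
  define U where "U = (\<Union>c\<in>C. V c)"
  have "open G" unfolding G_def using closed_Zn by (intro open_Diff) auto
  then have openV: "open (V c)" for c unfolding V_def by (rule open_connected_component)
  have VG: "V c \<subseteq> G" for c unfolding V_def by (rule connected_component_subset)
  have connV: "connected (V c)" for c unfolding V_def by (rule connected_connected_component)
  have cV: "c \<in> V c" if c: "c \<in> C" for c
  proof -
    have "c \<notin> Zn n" using avoid[OF c] by (simp add: Zn_def)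
    then show ?thesis unfolding V_def G_def using c critical_inside by auto
  qed
  have V_small: "\<exists>s t. c - r < s \<and> t < c + r \<and> V c \<subseteq> {s<..<t}" if c: "c \<in> C" for c
  proof -
    obtain s t where st: "s \<in> Zn n" "c - r < s" "s < c" "t \<in> Zn n" "c < t" "t < c + r"
      using n[OF c] by auto
    have int: "is_interval (V c)" using connV is_interval_connected_1 by blast
    have "s \<notin> V c" "t \<notin> V c" using st(1,4) VG unfolding G_def by blast+
    then have "x \<in> {s<..<t}" if "x \<in> V c" for x
      using mem_is_interval_1_I[OF int that cV[OF c], of s] mem_is_interval_1_I[OF int cV[OF c] that, of t] st
      by (cases "s < x"; cases "x < t") auto
    then show ?thesis using st by blast
  qed
  have V_sub: "V c \<subseteq> {c - r<..<c + r}" if "c \<in> C" for c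
    using V_small[OF that] by force
  have "open U" unfolding U_def using openV by blast
  have UG: "U \<subseteq> G" unfolding U_def using VG by blast
  have CU: "C \<subseteq> U" unfolding U_def using cV by blast
  have compU: "connected_component_set U c = V c" if c: "c \<in> C" for c
  proof
    show "connected_component_set U c \<subseteq> V c" unfolding V_def using UG by (rule connected_component_mono)
    show "V c \<subseteq> connected_component_set U c"
      using c by (intro connected_component_maximal cV connV) (auto simp: U_def)
  qed
  have front: "frontier U \<subseteq> Zn n"
  proof
    fix p assume p: "p \<in> frontier U"
    have "closure U = (\<Union>c\<in>C. closure (V c))"
      unfolding U_def using finite_critical by (induction rule: finite_induct) auto
    then obtain c where c: "c \<in> C" "p \<in> closure (V c)"
      using p by (auto simp: frontier_def)
    have "p \<notin> U" using p \<open>open U\<close> by (simp add: frontier_def interior_open)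
    show "p \<in> Zn n"
    proof (rule ccontr)
      assume "p \<notin> Zn n"
      obtain s t where st: "c - r < s" "t < c + r" "V c \<subseteq> {s<..<t}" using V_small[OF c(1)] by blast
      have "closure (V c) \<subseteq> {s..t}" using st(3) by (intro closure_minimal) auto
      then have "p \<in> {a<..<b}" using c(2) st room[OF c(1)] by auto
      then have "p \<in> G" using \<open>p \<notin> Zn n\<close> by (simp add: G_def)
      have "connected (insert p (V c))"
        using connected_intermediate_closure[OF connV, of c "insert p (V c)"] c(2) closure_subset by blast
      then have "insert p (V c) \<subseteq> V c"
        unfolding V_def using \<open>p \<in> G\<close> VG cV[OF c(1)] V_def
        by (intro connected_component_maximal) auto
      then show False using \<open>p \<notin> U\<close> c(1) unfolding U_def by blast
    qed
  qed
  have "nice_neighborhood a b f U"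
    unfolding nice_neighborhood_def
  proof (intro conjI ballI)
    show "open U" "C \<subseteq> U" by fact+
    show "U \<subseteq> {a..b}" using UG unfolding G_def by auto
    have "orb f (frontier U) \<subseteq> Zn n" unfolding orb_def using front Zn_funpow by blast
    then show "orb f (frontier U) \<inter> U = {}" using UG unfolding G_def by blast
    fix W assume "W \<in> components U"
    then obtain x where x: "x \<in> U" "W = connected_component_set U x" unfolding components_def by blast
    then obtain c where c: "c \<in> C" "x \<in> V c" unfolding U_def by blast
    then have "W = V c" using x(2) compU[OF c(1)] connected_component_eq by metis
    show "\<exists>!c. c \<in> C \<and> c \<in> W"
    proof (rule ex1I[of _ c])
      show "c \<in> C \<and> c \<in> W" using c(1) cV \<open>W = V c\<close> by blast
      fix c' assume c': "c' \<in> C \<and> c' \<in> W"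
      then have "c' \<in> {c - r<..<c + r}" using V_sub[OF c(1)] \<open>W = V c\<close> by blast
      then have "\<bar>c' - c\<bar> < e" using r(3) by (auto simp: abs_less_iff)
      then show "c' = c" using e(2) c' c(1) by blast
    qed
  qed
  moreover have "connected_component_set U c \<subseteq> {c - \<epsilon><..<c + \<epsilon>}" if "c \<in> C" for c
    using compU[OF that] V_sub[OF that] r(2) by auto
  ultimately show thesis using that by blast
qed

end

section \<open>Good intervals\<close>

text \<open>A monotone map onto an open set cannot attain an extremal value, neither on its domain nor, by
  continuity, at the end points of the domain.\<close>

lemma mono_onto_open_boundary:
  fixes g :: "real \<Rightarrow> real"
  assumes T: "is_interval T" "bounded T" "T \<noteq> {}" and cont: "continuous_on (closure T) g"
    and mono: "mono_on T g" and op: "open (g ` T)"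
  shows "open T" and "\<And>x. x \<in> closure T \<Longrightarrow> x \<notin> T \<Longrightarrow> g x \<notin> g ` T"
proof -
  have less: "y < z" if "y \<in> T" "z \<in> T" "g y < g z" for y z
  proof (rule ccontr)
    assume "\<not> y < z"
    then have "g z \<le> g y" using mono_onD[OF mono that(2,1)] by simp
    then show False using that(3) by simp
  qed
  have between: "\<exists>y\<in>T. \<exists>z\<in>T. g y < w \<and> w < g z" if w: "w \<in> g ` T" for w
  proof -
    obtain e where e: "e > 0" "ball w e \<subseteq> g ` T" using op w open_contains_ball by blast
    then have "w + e/2 \<in> g ` T" "w - e/2 \<in> g ` T" by (auto simp: subset_iff dist_real_def)
    then obtain y z where "y \<in> T" "z \<in> T" "g y = w - e/2" "g z = w + e/2" by (metis imageE)
    then show ?thesis using e(1) by (intro bexI[of _ y] bexI[of _ z]) auto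
  qed
  show "open T"
    unfolding open_subopen[of T]
  proof
    fix x assume x: "x \<in> T"
    obtain y z where yz: "y \<in> T" "z \<in> T" "g y < g x" "g x < g z" using between x by blast
    then have "x \<in> {y<..<z}" using less x by auto
    moreover have "{y<..<z} \<subseteq> T" using mem_is_interval_1_I[OF T(1) yz(1,2)] by auto
    ultimately show "\<exists>S. open S \<and> x \<in> S \<and> S \<subseteq> T" using open_greaterThanLessThan by blast
  qed
  then obtain s t where st: "s < t" "T = {s<..<t}" "closure T = {s..t}"
    using open_interval_Ioo T by metis
  fix x assume x: "x \<in> closure T" "x \<notin> T"
  show "g x \<notin> g ` T"
  proof
    assume "g x \<in> g ` T"
    then obtain y z where yz: "y \<in> T" "z \<in> T" "g y < g x" "g x < g z" using between by blast
    consider "x = s" | "x = t" using x st by force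
    then show False
    proof cases
      case 1
      have cl: "closure {s<..<y} = {s..y}" using yz(1) st(2) by simp
      then have "continuous_on (closure {s<..<y}) g"
        using cont yz(1) st by (auto intro: continuous_on_subset)
      moreover have "s \<in> closure {s<..<y}" using cl yz(1) st(2) by simp
      moreover have "g w \<le> g y" if "w \<in> {s<..<y}" for w
        using that yz(1) st(2) by (intro mono_onD[OF mono]) auto
      ultimately have "g s \<le> g y" by (rule continuous_le_on_closure)
      then show False using 1 yz(3) by simp
    next
      case 2
      have cl: "closure {z<..<t} = {z..t}" using yz(2) st(2) by simp
      then have "continuous_on (closure {z<..<t}) g"
        using cont yz(2) st by (auto intro: continuous_on_subset)
      moreover have "t \<in> closure {z<..<t}" using cl yz(2) st(2) by simp
      moreover have "g w \<ge> g z" if "w \<in> {z<..<t}" for w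
        using that yz(2) st(2) by (intro mono_onD[OF mono]) auto
      ultimately have "g t \<ge> g z" by (rule continuous_ge_on_closure)
      then show False using 2 yz(4) by simp
    qed
  qed
qed

lemma monotone_onto_open_boundary:
  fixes g :: "real \<Rightarrow> real"
  assumes T: "is_interval T" "bounded T" "T \<noteq> {}" and cont: "continuous_on (closure T) g"
    and mono: "mono_on T g \<or> antimono_on T g" and op: "open (g ` T)"
  shows "open T" and "\<And>x. x \<in> closure T \<Longrightarrow> x \<notin> T \<Longrightarrow> g x \<notin> g ` T"
proof -
  have "open T \<and> (\<forall>x. x \<in> closure T \<and> x \<notin> T \<longrightarrow> g x \<notin> g ` T)"
    using mono
  proof
    assume "mono_on T g"
    then show ?thesis using mono_onto_open_boundary[OF T cont _ op] by blast
  next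
    assume anti: "antimono_on T g"
    have m: "mono_on T (\<lambda>x. - g x)"
      using monotone_onD[OF anti] by (intro mono_onI) auto
    have c: "continuous_on (closure T) (\<lambda>x. - g x)" by (intro continuous_on_minus cont)
    have "(\<lambda>x. - g x) ` T = uminus ` g ` T" by (simp only: image_image)
    then have o: "open ((\<lambda>x. - g x) ` T)" using open_negations[OF op] by simp
    show ?thesis
    proof (intro conjI allI impI)
      show "open T" by (rule mono_onto_open_boundary(1)[OF T c m o])
      fix x assume x: "x \<in> closure T \<and> x \<notin> T"
      have "- g x \<notin> (\<lambda>x. - g x) ` T"
        by (rule mono_onto_open_boundary(2)[OF T c m o]) (use x in simp_all)
      then show "g x \<notin> g ` T" by (auto simp: image_iff)
    qed
  qed
  then show "open T" "\<And>x. x \<in> closure T \<Longrightarrow> x \<notin> T \<Longrightarrow> g x \<notin> g ` T" by blast+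
qed

context nonrenormalizable_expanding_map
begin

lemma open_critical_component:
  assumes nice: "nice_neighborhood a b f U"
  shows "open (connected_component_set U c)"
  using nice unfolding nice_neighborhood_def by (intro open_connected_component) blast

text \<open>A limit point of \<open>U\<^sub>c\<close> in \<open>U\<close> could be added to \<open>U\<^sub>c\<close> without disconnecting it.\<close>

lemma closure_component_minus:
  assumes nice: "nice_neighborhood a b f U" and c: "c \<in> C"
    and x: "x \<in> closure (connected_component_set U c)" "x \<notin> connected_component_set U c"
  shows "x \<in> frontier U"
proof -
  have U: "open U" "c \<in> U" using nice c unfolding nice_neighborhood_def by blast+
  have sub: "connected_component_set U c \<subseteq> U" by (rule connected_component_subset)
  have "x \<notin> U"
  proof
    assume "x \<in> U"
    have "connected (insert x (connected_component_set U c))"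
      by (rule connected_intermediate_closure[OF connected_connected_component[of U c]])
        (use x(1) closure_subset in blast)+
    moreover have "c \<in> insert x (connected_component_set U c)" using U(2) by simp
    moreover have "insert x (connected_component_set U c) \<subseteq> U" using \<open>x \<in> U\<close> sub by blast
    ultimately have "insert x (connected_component_set U c) \<subseteq> connected_component_set U c"
      by (intro connected_component_maximal)
    then show False using x(2) by blast
  qed
  moreover have "x \<in> closure U" using x(1) closure_mono[OF sub] by blast
  ultimately show ?thesis using U(1) by (simp add: frontier_def interior_open)
qed

lemma good_interval_facts:
  assumes nice: "nice_neighborhood a b f U" and T: "good_interval a b f U T n"
  shows "open T" "is_interval T" "T \<noteq> {}" "T \<subseteq> {a..b}" "(f ^^ n) ` T \<subseteq> U"
    and "x \<in> frontier T \<Longrightarrow> (f ^^ n) x \<in> frontier U"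
proof -
  obtain c where c: "c \<in> C" "good_interval_at a b f U c T n" using T unfolding good_interval_def by blast
  have int: "is_interval T" and sub: "T \<subseteq> {a..b}" and im: "(f ^^ n) ` T = connected_component_set U c"
    and mono: "mono_on T (f ^^ n) \<or> antimono_on T (f ^^ n)" and ne: "T \<noteq> {}"
    using c(2) unfolding good_interval_at_def proper_interval_def by blast+
  have bd: "bounded T" using sub bounded_closed_interval bounded_subset by blast
  have clT: "closure T \<subseteq> {a..b}" using sub by (intro closure_minimal) auto
  have cont: "continuous_on (closure T) (f ^^ n)" using continuous_funpow clT by (rule continuous_on_subset)
  have op: "open ((f ^^ n) ` T)" unfolding im by (rule open_critical_component[OF nice])
  note * = monotone_onto_open_boundary[OF int bd ne cont mono op]
  show "open T" "is_interval T" "T \<noteq> {}" "T \<subseteq> {a..b}" by (fact *(1) int ne sub)+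
  show "(f ^^ n) ` T \<subseteq> U" unfolding im by (rule connected_component_subset)
  assume "x \<in> frontier T"
  then have x: "x \<in> closure T" "x \<notin> T" using *(1) by (simp_all add: frontier_def interior_open)
  have "(f ^^ n) ` closure T \<subseteq> closure ((f ^^ n) ` T)"
    by (rule image_closure_subset[OF cont closed_closure closure_subset])
  then have "(f ^^ n) x \<in> closure (connected_component_set U c)" unfolding im using x(1) by blast
  moreover have "(f ^^ n) x \<notin> connected_component_set U c" using *(2)[OF x] unfolding im .
  ultimately show "(f ^^ n) x \<in> frontier U" by (rule closure_component_minus[OF nice c(1)])
qed

text \<open>A boundary point of the interval of smaller time is mapped to \<open>\<partial>U\<close>, so its later images avoid \<open>U\<close>
  and it cannot lie in the other interval.\<close>

lemma good_intervals_nested: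
  assumes nice: "nice_neighborhood a b f U"
    and S: "good_interval a b f U S m" and T: "good_interval a b f U T n"
    and "m \<le> n" "S \<inter> T \<noteq> {}"
  shows "T \<subseteq> S"
proof (rule ccontr)
  assume "\<not> T \<subseteq> S"
  moreover have "connected T" using good_interval_facts(2)[OF nice T] is_interval_connected_1 by blast
  ultimately have "T \<inter> frontier S \<noteq> {}"
    using assms(5) by (intro connected_Int_frontier) auto
  then obtain x where x: "x \<in> T" "x \<in> frontier S" by blast
  have "(f ^^ (n - m)) ((f ^^ m) x) \<in> orb f (frontier U)"
    unfolding orb_def using good_interval_facts(6)[OF nice S x(2)] by blast
  moreover have "(f ^^ (n - m)) ((f ^^ m) x) = (f ^^ n) x"
    using \<open>m \<le> n\<close> by (metis comp_apply funpow_add le_add_diff_inverse2)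
  moreover have "(f ^^ n) x \<in> U" using good_interval_facts(5)[OF nice T] x(1) by blast
  ultimately show False using nice unfolding nice_neighborhood_def by auto
qed

text \<open>The component of the Markov domain around a point is the good interval of minimal time.\<close>

lemma markov_domain_component:
  assumes nice: "nice_neighborhood a b f U" and W: "W \<in> components (markov_domain a b f U)"
  shows "\<exists>n\<ge>1. good_interval a b f U W n"
proof -
  let ?D = "markov_domain a b f U"
  obtain x where x: "x \<in> W" using in_components_nonempty[OF W] by blast
  have WD: "W \<subseteq> ?D" using W by (rule in_components_subset)
  define P where "P n \<longleftrightarrow> n \<ge> 1 \<and> (\<exists>T. good_interval a b f U T n \<and> x \<in> T)" for n
  have "\<exists>n. P n" using x WD unfolding P_def markov_domain_def by blast
  then have "P (LEAST n. P n)" by (rule LeastI_ex)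
  then obtain T where T: "(LEAST n. P n) \<ge> 1" "good_interval a b f U T (LEAST n. P n)" "x \<in> T"
    unfolding P_def by blast
  have "T \<subseteq> ?D" using T(1,2) unfolding markov_domain_def by blast
  moreover have "connected T" using good_interval_facts(2)[OF nice T(2)] is_interval_connected_1 by blast
  ultimately have TW: "T \<subseteq> W" using components_maximal[OF W] x T(3) by blast
  have "W \<subseteq> T"
  proof (rule ccontr)
    assume "\<not> W \<subseteq> T"
    then have "W \<inter> frontier T \<noteq> {}"
      using in_components_connected[OF W] x T(3) by (intro connected_Int_frontier) auto
    then obtain p where p: "p \<in> W" "p \<in> frontier T" by blast
    then obtain S m where S: "m \<ge> 1" "good_interval a b f U S m" "p \<in> S"
      using WD unfolding markov_domain_def by blast
    have pT: "p \<in> closure T" "p \<notin> T"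
      using p(2) good_interval_facts(1)[OF nice T(2)] by (simp_all add: frontier_def interior_open)
    have "S \<inter> closure T \<noteq> {}" using S(3) pT(1) by blast
    then have meet: "S \<inter> T \<noteq> {}"
      using open_Int_closure_eq_empty[OF good_interval_facts(1)[OF nice S(2)]] by blast
    show False
    proof (cases "(LEAST n. P n) \<le> m")
      case True
      then have "S \<subseteq> T" using good_intervals_nested[OF nice T(2) S(2)] meet by blast
      then show False using S(3) pT(2) by blast
    next
      case False
      then have "T \<subseteq> S" using good_intervals_nested[OF nice S(2) T(2)] meet by simp
      then have "P m" unfolding P_def using S(1,2) T(3) by blast
      then show False using False Least_le by blast
    qed
  qed
  then have "W = T" using TW by blast
  then show ?thesis using T(1,2) by blast
qed

lemma markov_map_exists:
  assumes nice: "nice_neighborhood a b f U"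
  shows "\<exists>M. is_markov_map a b f U M"
proof -
  let ?D = "markov_domain a b f U"
  define M where "M x = (f ^^ (SOME n. n \<ge> 1 \<and> good_interval a b f U (connected_component_set ?D x) n)) x" for x
  have "\<exists>n\<ge>1. good_interval a b f U T n \<and> (\<forall>x\<in>T. M x = (f ^^ n) x)" if T: "T \<in> components ?D" for T
  proof -
    define n where "n = (SOME n. n \<ge> 1 \<and> good_interval a b f U T n)"
    have "\<exists>n. n \<ge> 1 \<and> good_interval a b f U T n" using markov_domain_component[OF nice T] by blast
    then have "n \<ge> 1 \<and> good_interval a b f U T n" unfolding n_def by (rule someI_ex)
    moreover have "M x = (f ^^ n) x" if "x \<in> T" for x
    proof -
      have "connected_component_set ?D x = T"
        using T that by (metis components_iff connected_component_eq)
      then show ?thesis unfolding M_def n_def by simp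
    qed
    ultimately show ?thesis by blast
  qed
  then show ?thesis unfolding is_markov_map_def by blast
qed

section \<open>The Markov property\<close>


lemma good_interval_pullback:
  assumes T: "good_interval_at a b f U c T n"
    and S: "proper_interval S" "S \<subseteq> {a..b}" "has_slope (f ^^ m) \<beta> S" "(f ^^ m) ` S = T"
  shows "good_interval_at a b f U c S (n + m)"
proof -
  have eq: "f ^^ (n + m) = f ^^ n \<circ> f ^^ m" by (simp only: funpow_add)
  have mem: "(f ^^ m) x \<in> T" if "x \<in> S" for x using S(4) that by blast
  have "mono_on T (f ^^ n) \<or> antimono_on T (f ^^ n)" using T unfolding good_interval_at_def by blast
  then have "mono_on S (f ^^ n \<circ> f ^^ m) \<or> antimono_on S (f ^^ n \<circ> f ^^ m)"
    using has_slope_mono[OF S(3)] mem unfolding monotone_on_def comp_def by (elim disjE) simp_all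
  moreover have "(f ^^ n \<circ> f ^^ m) ` S = connected_component_set U c"
    unfolding image_comp[symmetric] S(4) using T unfolding good_interval_at_def by blast
  ultimately show ?thesis unfolding good_interval_at_def eq using S(1,2) by blast
qed

lemma critical_points_nonempty: "C \<noteq> {}"
proof
  assume "C = {}"
  then obtain \<beta> where \<beta>: "has_slope f \<beta> {a..b}" using slope_off_critical[of a b] ab by auto
  have "\<exists>\<gamma>. has_slope (f ^^ n) \<gamma> {a..b}" for n
  proof (induction n)
    case 0
    show ?case using has_slope_funpow_0 by blast
  next
    case (Suc n)
    then obtain \<gamma> where \<gamma>: "has_slope (f ^^ n) \<gamma> {a..b}" by blast
    have "has_slope (f ^^ 1) \<beta> ((f ^^ n) ` {a..b})"
      using has_slope_subset[OF \<beta> funpow_maps] by simp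
    then have "has_slope (f ^^ (1 + n)) (\<beta> * \<gamma>) {a..b}" by (rule has_slope_funpow_add[OF \<gamma>])
    then show ?case unfolding plus_1_eq_Suc by blast
  qed
  then show False using not_always_affine[OF order_refl ab order_refl] by metis
qed

text \<open>The bounds \<open>p\<close> and \<open>q\<close> confine the neighborhood of \<open>x\<close> to a prescribed interval.\<close>

lemma affine_near_noncritical_orbit:
  assumes "p < x" "x < q" "\<forall>i<n. (f ^^ i) x \<in> {a<..<b} - C"
  shows "\<exists>r>0. \<exists>\<beta>. \<beta> \<noteq> 0 \<and> p < x - r \<and> x + r < q \<and> has_slope (f ^^ n) \<beta> {x - r..x + r}"
  using assms(3)
proof (induction n)
  case 0
  obtain r where "0 < r" "r < min (x - p) (q - x)" using dense[of 0 "min (x - p) (q - x)"] assms(1,2) by auto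
  then have "p < x - r" "x + r < q" by auto
  moreover have "has_slope (f ^^ 0) 1 {x - r..x + r}" by (rule has_slope_funpow_0)
  moreover have "(1::real) \<noteq> 0" by simp
  ultimately show ?case using \<open>0 < r\<close> by blast
next
  case (Suc n)
  then obtain r \<beta> where r: "r > 0" "\<beta> \<noteq> 0" "p < x - r" "x + r < q" "has_slope (f ^^ n) \<beta> {x - r..x + r}" by auto
  let ?y = "(f ^^ n) x"
  have "open ({a<..<b} - C)" using finite_critical by (intro open_Diff finite_imp_closed) auto
  moreover have "?y \<in> {a<..<b} - C" using Suc.prems by blast
  ultimately obtain e where e: "e > 0" "cball ?y e \<subseteq> {a<..<b} - C" using open_contains_cball by blast
  have sub: "{?y - e..?y + e} \<subseteq> {a<..<b} - C" using e(2) by (auto simp: subset_iff dist_real_def)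
  have "?y - e \<in> {?y - e..?y + e}" "?y + e \<in> {?y - e..?y + e}" using e(1) by auto
  then have "?y - e \<in> {a<..<b}" "?y + e \<in> {a<..<b}" using sub by blast+
  moreover have "{?y - e<..<?y + e} \<inter> C = {}"
    using sub greaterThanLessThan_subseteq_atLeastAtMost_iff[of "?y - e" "?y + e" "?y - e" "?y + e"] by blast
  ultimately obtain \<gamma> where \<gamma>: "\<gamma> \<noteq> 0" "has_slope f \<gamma> {?y - e..?y + e}"
    using slope_off_critical[of "?y - e" "?y + e"] e(1) by auto
  define r' where "r' = min r (e / \<bar>\<beta>\<bar>)"
  have r': "r' > 0" "r' \<le> r" "\<bar>\<beta>\<bar> * r' \<le> e"
  proof -
    show "r' > 0" "r' \<le> r" using r(1,2) e(1) by (auto simp: r'_def)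
    have "r' \<le> e / \<bar>\<beta>\<bar>" by (simp add: r'_def)
    then show "\<bar>\<beta>\<bar> * r' \<le> e" using r(2) by (simp add: field_simps)
  qed
  have sl: "has_slope (f ^^ n) \<beta> {x - r'..x + r'}" by (rule has_slope_subset[OF r(5)]) (use r' in auto)
  have "(f ^^ n) ` {x - r'..x + r'} \<subseteq> {?y - e..?y + e}"
  proof
    fix w assume "w \<in> (f ^^ n) ` {x - r'..x + r'}"
    then obtain z where z: "z \<in> {x - r'..x + r'}" "w = (f ^^ n) z" by blast
    have "w - ?y = \<beta> * (z - x)" using has_slopeD[OF sl _ z(1), of x] z(2) r'(1) by auto
    then have "\<bar>w - ?y\<bar> = \<bar>\<beta>\<bar> * \<bar>z - x\<bar>" by (simp add: abs_mult)
    also have "\<dots> \<le> \<bar>\<beta>\<bar> * r'" using z(1) by (intro mult_left_mono) auto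
    finally have "\<bar>w - ?y\<bar> \<le> e" using r'(3) by simp
    then show "w \<in> {?y - e..?y + e}" by (auto simp: abs_le_iff)
  qed
  then have "has_slope (f ^^ 1) \<gamma> ((f ^^ n) ` {x - r'..x + r'})"
    using has_slope_subset[OF \<gamma>(2)] by simp
  then have "has_slope (f ^^ (1 + n)) (\<gamma> * \<beta>) {x - r'..x + r'}" by (rule has_slope_funpow_add[OF sl])
  moreover have "\<gamma> * \<beta> \<noteq> 0" "p < x - r'" "x + r' < q" using \<gamma>(1) r r' by auto
  ultimately show ?case unfolding plus_1_eq_Suc using r'(1) by blast
qed

lemma affine_onto_critical_neighborhood:
  assumes pq: "a \<le> p" "p < q" "q \<le> b" and c: "c \<in> C"
  shows "\<exists>\<eta>>0. \<exists>n\<ge>1. \<exists>s t \<beta>. p \<le> s \<and> s < t \<and> t \<le> q \<and> \<beta> \<noteq> 0 \<and> has_slope (f ^^ n) \<beta> {s..t} \<and>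
     {c - \<eta>..c + \<eta>} \<subseteq> (f ^^ n) ` {s..t}"
proof -
  \<comment> \<open>staying away from \<open>c\<close> itself forces a positive time\<close>
  obtain p' q' where p'q': "p < p'" "p' < q'" "q' < q" "{p'..q'} \<inter> {c} = {}"
    using subinterval_avoiding_finite[OF _ pq(2), of "{c}"] by blast
  have "c \<in> {a<..<b}" using c critical_inside by blast
  moreover have "a \<le> p'" "q' \<le> b" using pq p'q' by linarith+
  ultimately obtain x where x: "x \<in> noncritical_preorbit c" "x \<in> {p'<..<q'}"
    using noncritical_preorbit_dense[of c p' q'] p'q'(2) by blast
  then obtain n where n: "(f ^^ n) x = c" "\<forall>i<n. (f ^^ i) x \<in> {a<..<b} - C"
    unfolding noncritical_preorbit_def by blast
  have "x \<noteq> c" using x(2) p'q'(4) by auto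
  then have "n \<noteq> 0" using n(1) by (auto intro: ccontr)
  obtain r \<beta> where r: "r > 0" "\<beta> \<noteq> 0" "p' < x - r" "x + r < q'" "has_slope (f ^^ n) \<beta> {x - r..x + r}"
    using affine_near_noncritical_orbit[OF _ _ n(2), of p' q'] x(2) by auto
  have "x - r \<le> x + r" using r(1) by simp
  then obtain s t where st: "(f ^^ n) ` {x - r..x + r} = {s..t}"
    by (rule has_slope_image_Icc[OF r(5)])
  have "(f ^^ n) (x + r) = c + \<beta> * r" "(f ^^ n) (x - r) = c - \<beta> * r"
    using has_slopeD[OF r(5), of x] n(1) r(1) by auto
  moreover have "(f ^^ n) (x + r) \<in> {s..t}" "(f ^^ n) (x - r) \<in> {s..t}"
    unfolding st[symmetric] using r(1) by auto
  ultimately have "s \<le> c - \<bar>\<beta>\<bar> * r" "c + \<bar>\<beta>\<bar> * r \<le> t" by (auto simp: abs_if)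
  then have "{c - \<bar>\<beta>\<bar> * r..c + \<bar>\<beta>\<bar> * r} \<subseteq> (f ^^ n) ` {x - r..x + r}" unfolding st by auto
  moreover have "\<bar>\<beta>\<bar> * r > 0" using r(1,2) by simp
  moreover have "p \<le> x - r" "x - r < x + r" "x + r \<le> q" using r p'q' by auto
  moreover have "n \<ge> 1" using \<open>n \<noteq> 0\<close> by simp
  ultimately show ?thesis using r(2,5) by blast
qed

text \<open>Up to an affine iterate every interval contains one of the finitely many grid intervals, and each of
  them contains an interval mapped affinely onto a neighborhood of \<open>c\<close>. So the mesh only has to be
  smaller than finitely many positive numbers.\<close>

lemma small_mesh_if_small:
  obtains \<epsilon> where "\<epsilon> > 0"
    "\<And>U. nice_neighborhood a b f U \<Longrightarrow> (\<And>c. c \<in> C \<Longrightarrow> connected_component_set U c \<subseteq> {c - \<epsilon><..<c + \<epsilon>}) \<Longrightarrow>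
      small_mesh a b f U"
proof -
  obtain \<delta> where \<delta>: "growth_scale \<delta>" using growth_scale_exists by blast
  obtain J where grid: "is_grid \<delta> J" using grid_exists[OF \<delta>] by blast
  then have J: "finite J" "\<And>p q. (p, q) \<in> J \<Longrightarrow> a \<le> p \<and> p < q \<and> q \<le> b"
    unfolding is_grid_def by blast+
  define onto where "onto p q c \<eta> \<longleftrightarrow> (\<exists>n\<ge>1. \<exists>s t \<beta>. p \<le> s \<and> s < t \<and> t \<le> q \<and> \<beta> \<noteq> 0 \<and> has_slope (f ^^ n) \<beta> {s..t} \<and>
     {c - \<eta>..c + \<eta>} \<subseteq> (f ^^ n) ` {s..t})" for p q c \<eta>
  have "\<exists>\<eta>>0. onto (fst (fst x)) (snd (fst x)) (snd x) \<eta>" if "x \<in> J \<times> C" for x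
    using affine_onto_critical_neighborhood[of "fst (fst x)" "snd (fst x)" "snd x"] J(2)[of "fst (fst x)" "snd (fst x)"] that
    unfolding onto_def by auto
  then obtain \<eta> where \<eta>: "\<And>x. x \<in> J \<times> C \<Longrightarrow> \<eta> x > 0" "\<And>x. x \<in> J \<times> C \<Longrightarrow> onto (fst (fst x)) (snd (fst x)) (snd x) (\<eta> x)"
    by metis
  define \<epsilon> where "\<epsilon> = Min (insert 1 (\<eta> ` (J \<times> C)))"
  have fin: "finite (\<eta> ` (J \<times> C))" using J(1) finite_critical by blast
  have "\<epsilon> > 0" unfolding \<epsilon>_def using fin \<eta>(1) by (subst Min_gr_iff) auto
  have \<epsilon>: "\<epsilon> \<le> \<eta> x" if "x \<in> J \<times> C" for x unfolding \<epsilon>_def using fin that by (intro Min_le) auto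
  have "small_mesh a b f U"
    if nice: "nice_neighborhood a b f U" and small: "\<And>c. c \<in> C \<Longrightarrow> connected_component_set U c \<subseteq> {c - \<epsilon><..<c + \<epsilon>}" for U
    unfolding small_mesh_def
  proof (intro allI impI ballI)
    fix I c assume I: "proper_interval I \<and> I \<subseteq> {a..b}" and c: "c \<in> C"
    let ?V = "connected_component_set U c"
    obtain u v where uv: "u \<in> I" "v \<in> I" "u < v" using I unfolding proper_interval_def by blast
    have int: "is_interval I" using I unfolding proper_interval_def by blast
    have uvI: "{u..v} \<subseteq> I" using mem_is_interval_1_I[OF int uv(1,2)] by auto
    have "a \<le> u" "v \<le> b" using uv I by auto
    then obtain p q u' v' m \<beta> where 1: "(p, q) \<in> J" "u \<le> u'" "u' < v'" "v' \<le> v" "\<beta> \<noteq> 0"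
      "has_slope (f ^^ m) \<beta> {u'..v'}" "(f ^^ m) ` {u'..v'} = {p..q}"
      using affine_onto_grid[OF \<delta> grid _ uv(3)] by metis
    have JC: "((p, q), c) \<in> J \<times> C" using 1(1) c by simp
    obtain n s t \<gamma> where 2: "n \<ge> 1" "p \<le> s" "s < t" "t \<le> q" "\<gamma> \<noteq> 0" "has_slope (f ^^ n) \<gamma> {s..t}"
      "{c - \<eta> ((p, q), c)..c + \<eta> ((p, q), c)} \<subseteq> (f ^^ n) ` {s..t}"
      using \<eta>(2)[OF JC] unfolding onto_def by auto
    have V: "open ?V" "is_interval ?V" "bounded ?V" "?V \<noteq> {}"
    proof -
      show "open ?V" by (rule open_critical_component[OF nice])
      show "is_interval ?V" using connected_connected_component is_interval_connected_1 by blast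
      have "bounded {c - \<epsilon><..<c + \<epsilon>}" by simp
      then show "bounded ?V" using small[OF c] by (rule bounded_subset)
      have "c \<in> U" using nice c unfolding nice_neighborhood_def by blast
      then show "?V \<noteq> {}" using connected_component_refl by blast
    qed
    obtain l r where lr: "l < r" "?V = {l<..<r}" by (rule open_interval_Ioo[OF V])
    have "{l<..<r} \<subseteq> {c - \<epsilon><..<c + \<epsilon>}" using small[OF c] lr(2) by simp
    then have "c - \<epsilon> \<le> l" "r \<le> c + \<epsilon>" using lr(1) by (simp_all add: greaterThanLessThan_subseteq_greaterThanLessThan)
    then have "{l..r} \<subseteq> {c - \<eta> ((p, q), c)..c + \<eta> ((p, q), c)}" using \<epsilon>[OF JC] by auto
    then have "{l..r} \<subseteq> (f ^^ n) ` {s..t}" using 2(7) by blast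
    then obtain x y where xy: "{x..y} \<subseteq> {s..t}" "x < y" "(f ^^ n) ` {x<..<y} = {l<..<r}"
      using has_slope_preimage_Icc[OF 2(6,5) lr(1)] by metis
    have "{x..y} \<subseteq> (f ^^ m) ` {u'..v'}" unfolding 1(7) using xy(1) 2(2,4) by (meson atLeastatMost_subset_iff order_trans)
    then obtain x' y' where xy': "{x'..y'} \<subseteq> {u'..v'}" "x' < y'" "(f ^^ m) ` {x'<..<y'} = {x<..<y}"
      using has_slope_preimage_Icc[OF 1(6,5) xy(2)] by metis
    have proper: "proper_interval {x<..<y}" if "x < y" for x y :: real
    proof -
      obtain w z where "x < w" "w < z" "z < y" using dense \<open>x < y\<close> by metis
      then show ?thesis unfolding proper_interval_def
        by (intro conjI bexI[of _ w] bexI[of _ z]) (auto simp: is_interval_oo)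
    qed
    have open_closed: "{x<..<y} \<subseteq> {x..y}" for x y :: real by auto
    have sub': "{x'<..<y'} \<subseteq> {u'..v'}" using xy'(1) open_closed by blast
    have u'v'I: "{u'..v'} \<subseteq> I" using uvI 1(2,4) by (meson atLeastatMost_subset_iff order_trans)
    have "{x<..<y} \<subseteq> {s..t}" using xy(1) open_closed by blast
    moreover have "{s..t} \<subseteq> {a..b}" using 2(2,4) J(2)[OF 1(1)] by auto
    ultimately have "good_interval_at a b f U c {x<..<y} n"
      unfolding good_interval_at_def
      using proper[OF xy(2)] xy(3) lr(2) has_slope_mono[OF has_slope_subset[OF 2(6)]] by blast
    then have "good_interval_at a b f U c {x'<..<y'} (n + m)"
      using sub' u'v'I I by (intro good_interval_pullback[OF _ proper[OF xy'(2)] _ has_slope_subset[OF 1(6)] xy'(3)]) blast+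
    moreover have "n + m \<ge> 1" using 2(1) by simp
    moreover have "{x'<..<y'} \<subseteq> I" using sub' u'v'I by blast
    ultimately show "\<exists>T n. n \<ge> 1 \<and> T \<subseteq> I \<and> good_interval_at a b f U c T n" by blast
  qed
  then show thesis using that \<open>\<epsilon> > 0\<close> by blast
qed

text \<open>The Markov domain contains a fixed proportion \<open>\<kappa>\<close> of every grid interval, hence of every interval with a
  large affine image. By the choice of the scale, a bound \<open>\<theta>\<close> on the density of the complement in all
  intervals improves to \<open>(1 - \<kappa>) \<theta>\<close>, and the density is zero.\<close>

lemma markov_domain_full_measure:
  assumes nice: "nice_neighborhood a b f U" and small: "small_mesh a b f U"
  shows "{a..b} - markov_domain a b f U \<in> null_sets lebesgue"
proof -
  let ?D = "markov_domain a b f U"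
  let ?E = "{a..b} - ?D"
  let ?\<mu> = "\<lambda>x y. measure lebesgue (?E \<inter> {x..y})"
  have good_open: "open T" if "T \<in> {T. \<exists>n\<ge>1. good_interval a b f U T n}" for T
    using that good_interval_facts(1)[OF nice] by blast
  have "open ?D" unfolding markov_domain_def by (intro open_Union ballI good_open)
  then have "closed ?E" by (intro closed_Diff) auto
  then have E: "?E \<in> sets lebesgue" by (metis borel_closed sets_completionI_sets sets_lborel)
  obtain \<delta> where \<delta>: "growth_scale \<delta>" using growth_scale_exists by blast
  obtain J where grid: "is_grid \<delta> J" using grid_exists[OF \<delta>] by blast
  then have J: "finite J" "\<And>p q. (p, q) \<in> J \<Longrightarrow> a \<le> p \<and> p < q \<and> q \<le> b"
    unfolding is_grid_def by blast+
  obtain c where c: "c \<in> C" using critical_points_nonempty by blast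
  define has_good where "has_good p q l \<longleftrightarrow> (\<exists>r s n. p \<le> r \<and> r < s \<and> s \<le> q \<and> l = s - r \<and> n \<ge> 1 \<and>
      good_interval_at a b f U c {r<..<s} n)" for p q l
  have "\<exists>l>0. has_good (fst x) (snd x) l" if xJ: "x \<in> J" for x
  proof -
    have pq: "a \<le> fst x" "fst x < snd x" "snd x \<le> b" using J(2)[of "fst x" "snd x"] xJ by auto
    have "proper_interval {fst x..snd x}" unfolding proper_interval_def
      using pq(2) is_interval_cc by (metis atLeastAtMost_iff less_imp_le order_refl)
    moreover have "{fst x..snd x} \<subseteq> {a..b}" using pq by auto
    ultimately obtain T n where T: "n \<ge> 1" "T \<subseteq> {fst x..snd x}" "good_interval_at a b f U c T n"
      using small c unfolding small_mesh_def by blast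
    then have good: "good_interval a b f U T n" unfolding good_interval_def using c by blast
    have "bounded T" using T(2) bounded_closed_interval bounded_subset by blast
    then obtain r s where rs: "r < s" "T = {r<..<s}" "closure T = {r..s}"
      using open_interval_Ioo good_interval_facts(1-3)[OF nice good] by metis
    have "{r..s} \<subseteq> {fst x..snd x}" unfolding rs(3)[symmetric] using T(2) by (intro closure_minimal) auto
    then have "fst x \<le> r" "s \<le> snd x" using rs(1) by auto
    then show ?thesis unfolding has_good_def using rs T by (intro exI[of _ "s - r"]) auto
  qed
  then obtain len where len: "\<And>x. x \<in> J \<Longrightarrow> len x > 0" "\<And>x. x \<in> J \<Longrightarrow> has_good (fst x) (snd x) (len x)" by metis
  \<comment> \<open>the element 1 ensures \<open>\<kappa> \<le> 1\<close>, so that the powers of \<open>1 - \<kappa>\<close> are not negative\<close>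
  define \<kappa> where "\<kappa> = Min (insert 1 ((\<lambda>x. len x / (b - a)) ` J))"
  have "0 < len x / (b - a)" if "x \<in> J" for x using len(1)[OF that] ab by simp
  then have \<kappa>0: "\<kappa> > 0" unfolding \<kappa>_def using J(1) by (subst Min_gr_iff) auto
  have \<kappa>1: "\<kappa> \<le> 1" unfolding \<kappa>_def using J(1) by (intro Min_le) auto
  have \<kappa>: "\<kappa> * (b - a) \<le> len x" if "x \<in> J" for x
  proof -
    have "\<kappa> \<le> len x / (b - a)" unfolding \<kappa>_def using J(1) that by (intro Min_le) auto
    then show ?thesis using ab by (simp add: pos_le_divide_eq)
  qed
  have bound: "?\<mu> u v \<le> (1 - \<kappa>) ^ k * (v - u)" if "a \<le> u" "u \<le> v" "v \<le> b" for k u v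
    using that
  proof (induction k arbitrary: u v)
    case 0
    then show ?case using measure_Int_Icc_le[OF E] by simp
  next
    case (Suc k)
    have "?\<mu> u' v' \<le> (1 - \<kappa>) ^ Suc k * (v' - u')"
      if large: "u \<le> u'" "u' < v'" "v' \<le> v" "has_slope (f ^^ m) \<beta> {u'..v'}" "\<delta> \<le> \<bar>\<beta>\<bar> * (v' - u')" for u' v' m \<beta>
    proof -
      have uv': "a \<le> u'" "v' \<le> b" using large Suc.prems by auto
      have nz: "\<beta> \<noteq> 0" using large(5) \<delta> unfolding growth_scale_def by auto
      obtain x y where xy: "(f ^^ m) ` {u'..v'} = {x..y}" "y - x = \<bar>\<beta>\<bar> * (v' - u')"
        using has_slope_image_Icc[OF large(4)] large(2) by (metis less_imp_le)
      have pos: "0 < \<bar>\<beta>\<bar> * (v' - u')" using nz large(2) by simp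
      have "{x..y} \<subseteq> {a..b}"
        unfolding xy(1)[symmetric] using uv' by (intro image_subsetI funpow_in) auto
      then have xyab: "a \<le> x \<and> y \<le> b" using xy(2) pos by auto
      then obtain p q where pq: "(p, q) \<in> J" "x \<le> p" "q \<le> y"
        using grid large(5) unfolding xy(2)[symmetric] is_grid_def by blast
      obtain r s n where rs: "p \<le> r" "r < s" "s \<le> q" "len (p, q) = s - r" "n \<ge> 1" "good_interval_at a b f U c {r<..<s} n"
        using len(2)[OF pq(1)] unfolding has_good_def by auto
      have "{r..s} \<subseteq> (f ^^ m) ` {u'..v'}" unfolding xy(1) using rs pq by auto
      then obtain w z where wz: "{w..z} \<subseteq> {u'..v'}" "w < z" "(f ^^ m) ` {w<..<z} = {r<..<s}" "s - r = \<bar>\<beta>\<bar> * (z - w)"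
        using has_slope_preimage_Icc[OF large(4) nz rs(2)] by metis
      have wz': "u' \<le> w" "z \<le> v'" using wz(1,2) by auto
      have sub: "{w<..<z} \<subseteq> {u'..v'}" using wz' by auto
      have "proper_interval {w<..<z}"
      proof -
        obtain i j where "w < i" "i < j" "j < z" using dense wz(2) by metis
        then show ?thesis unfolding proper_interval_def
          by (intro conjI bexI[of _ i] bexI[of _ j]) (auto simp: is_interval_oo)
      qed
      moreover have "{w<..<z} \<subseteq> {a..b}" using wz' uv' by auto
      ultimately have "good_interval_at a b f U c {w<..<z} (n + m)"
        by (rule good_interval_pullback[OF rs(6) _ _ has_slope_subset[OF large(4) sub] wz(3)])
      moreover have "n + m \<ge> 1" using rs(5) by simp
      ultimately have "{w<..<z} \<subseteq> ?D" unfolding markov_domain_def good_interval_def using c by blast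
      then have "?E \<inter> {w..z} \<subseteq> {w, z}" by force
      then have "finite (?E \<inter> {w..z})" by (rule finite_subset) simp
      then have "?\<mu> w z = 0" by (intro negligible_imp_measure0 negligible_finite)
      moreover have "?\<mu> u' v' \<le> ?\<mu> u' w + ?\<mu> w v'" "?\<mu> w v' \<le> ?\<mu> w z + ?\<mu> z v'"
        using wz' wz(2) by (auto intro!: measure_Int_Icc_split[OF E])
      moreover have "?\<mu> u' w \<le> (1 - \<kappa>) ^ k * (w - u')" "?\<mu> z v' \<le> (1 - \<kappa>) ^ k * (v' - z)"
        using wz' wz(2) uv' by (auto intro!: Suc.IH)
      moreover have "(1 - \<kappa>) ^ k * (w - u') + (1 - \<kappa>) ^ k * (v' - z) = (1 - \<kappa>) ^ k * ((v' - u') - (z - w))"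
        by (simp add: algebra_simps)
      moreover have "(1 - \<kappa>) ^ k * ((v' - u') - (z - w)) \<le> (1 - \<kappa>) ^ k * ((1 - \<kappa>) * (v' - u'))"
      proof (intro mult_left_mono)
        have "\<bar>\<beta>\<bar> * (\<kappa> * (v' - u')) = \<kappa> * (y - x)" unfolding xy(2) by simp
        also have "\<dots> \<le> \<kappa> * (b - a)" using xyab \<kappa>0 by (intro mult_left_mono) auto
        also have "\<dots> \<le> \<bar>\<beta>\<bar> * (z - w)" using \<kappa>[OF pq(1)] rs(4) wz(4) by simp
        finally have "\<kappa> * (v' - u') \<le> z - w" using nz by simp
        then show "v' - u' - (z - w) \<le> (1 - \<kappa>) * (v' - u')" by (simp add: left_diff_distrib)
      qed (use \<kappa>1 in simp)
      moreover have "(1 - \<kappa>) ^ k * ((1 - \<kappa>) * (v' - u')) = (1 - \<kappa>) ^ Suc k * (v' - u')" by simp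
      ultimately show ?thesis by linarith
    qed
    then have "\<forall>u' v' m \<beta>. u \<le> u' \<and> u' < v' \<and> v' \<le> v \<and> has_slope (f ^^ m) \<beta> {u'..v'} \<and> \<delta> \<le> \<bar>\<beta>\<bar> * (v' - u') \<longrightarrow>
        ?\<mu> u' v' \<le> (1 - \<kappa>) ^ Suc k * (v' - u')" by blast
    moreover have "0 \<le> (1 - \<kappa>) ^ Suc k" using \<kappa>1 by simp
    ultimately show ?case using \<delta> E Suc.prems unfolding growth_scale_def by blast
  qed
  have "?\<mu> a b \<le> (1 - \<kappa>) ^ k * (b - a)" for k using bound ab by simp
  moreover have "(\<lambda>k. (1 - \<kappa>) ^ k * (b - a)) \<longlonglongrightarrow> 0 * (b - a)"
    using \<kappa>0 \<kappa>1 by (intro tendsto_intros LIMSEQ_power_zero) auto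
  ultimately have "?\<mu> a b \<le> 0 * (b - a)" by (intro LIMSEQ_le_const) auto
  moreover have "?E \<inter> {a..b} = ?E" by blast
  ultimately have "measure lebesgue ?E = 0" by (simp add: measure_le_0_iff)
  moreover have "?E \<in> lmeasurable"
    using E by (intro bounded_set_imp_lmeasurable) (auto intro: bounded_subset[OF bounded_closed_interval])
  ultimately show ?thesis using negligible_iff_measure negligible_iff_null_sets by blast
qed

end

theorem theoremB:
  fixes a b :: real and f :: "real \<Rightarrow> real"
  assumes "a < b"
    and "piecewise_affine a b f"
    and "eventually_expanding a b f"
    and "non_renormalizable a b f"
  shows "markov_property a b f"
proof -
  interpret nonrenormalizable_expanding_map a b f
    by unfold_locales (fact assms)+
  obtain \<epsilon> where \<epsilon>: "\<epsilon> > 0"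
    "\<And>U. nice_neighborhood a b f U \<Longrightarrow> (\<And>c. c \<in> C \<Longrightarrow> connected_component_set U c \<subseteq> {c - \<epsilon><..<c + \<epsilon>}) \<Longrightarrow>
      small_mesh a b f U"
    using small_mesh_if_small by blast
  obtain U where U: "nice_neighborhood a b f U" "\<And>c. c \<in> C \<Longrightarrow> connected_component_set U c \<subseteq> {c - \<epsilon><..<c + \<epsilon>}"
    using small_nice_neighborhood[OF \<epsilon>(1)] by blast
  then have "small_mesh a b f U" by (rule \<epsilon>(2))
  moreover obtain M where "is_markov_map a b f U M" using markov_map_exists[OF U(1)] by blast
  ultimately show ?thesis
    unfolding markov_property_def using U(1) markov_domain_full_measure by blast
qed

end
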